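(* Let $G=(V,w,m)$ be a graph and let $K\in\mathbb R$. The following statements are equivalent: (1) $Ric(G)\ge K$. (2) For all $f\in C_c(V)$ and all $t>0$, $\|\nabla P_tf\|_\infty\le e^{-Kt}\|\nabla f\|_\infty$. (3) For all $f\in\ell_\infty(V)$ and all $t>0$, $\|\nabla P_tf\|_\infty\le e^{-Kt}\|\nabla f\|_\infty$. (4) $G$ is stochastically complete and for all $x,y\in V$ and all $t>0$, $W(p_t^x,p_t^y)\le e^{-Kt}d(x,y)$, where $p_t^x:=\frac{m}{m(x)}P_t1_x$ denotes the heat kernel, i.e. $p_t^x(z)=\frac{m(z)}{m(x)}P_t1_x(z)$ for $z\in V$.
   Context: A graph is a triple $G=(V,w,m)$ with $V$ a countable set, $w:V\times V\to[0,\infty)$ symmetric and zero on the diagonal, and $m:V\to(0,\infty)$. Write $x\sim y$ if $w(x,y)>0$. All graphs are locally finite (for each $x$ only finitely many $y$ satisfy $x\sim y$) and connected; $d(x,y)=\inf\{n: x=x_0\sim\cdots\sim x_n=y\}$ is the combinatorial distance, which is finite by connectedness. The Laplacian is $\Delta f(x)=\frac1{m(x)}\sum_{y\in V}w(x,y)(f(y)-f(x))$, and $\mathrm{Deg}(x)=\frac1{m(x)}\sum_{y}w(x,y)$. $C_c(V)$ denotes the finitely supported and $\ell_\infty(V)$ the bounded functions $V\to\mathbb R$. For $x\ne y$, $\nabla_{xy}f=\frac{f(x)-f(y)}{d(x,y)}$, and $\|\nabla f\|_\infty=\sup_{x\ne y}|\nabla_{xy}f|$. $Lip(1)$ is the set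 of $f:V\to\mathbb R$ with $|f(x)-f(y)|\le d(x,y)$ for all $x,y$. Heat semigroup: for non-negative $f\in\ell_\infty(V)$, $P_tf(x)=u(x,t)$ is the smallest non-negative bounded continuous solution of $\partial_tu=\Delta u$ on $V\times[0,\infty)$, $u(\cdot,0)=f$; it is extended linearly to all $f\in\ell_\infty(V)$. $G$ is stochastically complete if $P_t\mathbf 1=\mathbf 1$ for all $t>0$, where $\mathbf 1$ is the constant function $1$; in this case each $p_t^x$ is a probability measure. Curvature: for $x\in V$ and $\varepsilon>0$ let $m_x^\varepsilon(x)=1-\varepsilon\,\mathrm{Deg}(x)$ and $m_x^\varepsilon(y)=\varepsilon w(x,y)/m(x)$ for $y\neq x$; this is a finitely supported probability measure for $\varepsilon$ small. For probability measures $\mu,\nu$ on $V$, $W(\mu,\nu)=\sup_{f}\sum_{x}f(x)(\mu(x)-\nu(x))$, the supremum over bounded $f\in Lip(1)$. For $x\neq y$ let $\kappa_\varepsilon(x,y)=1-\frac{W(m_x^\varepsilon,m_y^\varepsilon)}{d(x,y)}$ and $\kappa(x,y)=\lim_{\varepsilon\to0^+}\frac1\varepsilon\kappa_\varepsilon(x,y)$ (this limit exists). $Ric(G)\ge K$ means $\kappa(x,y)\ge K$ for all $x\ne y$. *)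

theory Defs
  imports "HOL-Analysis.Analysis"
begin

text \<open>
  The countable vertex set is the type \<open>'v\<close>; a graph is given by the edge weight
  \<open>w\<close> and the vertex measure \<open>m\<close>. Infinite values of suprema are kept by working
  in \<^typ>\<open>ennreal\<close> and \<^typ>\<open>ereal\<close>.
\<close>

definition edges :: "('v \<Rightarrow> 'v \<Rightarrow> real) \<Rightarrow> ('v \<times> 'v) set" where
  "edges w = {(x, y). w x y > 0}"

locale weighted_graph =
  fixes w :: "'v::countable \<Rightarrow> 'v \<Rightarrow> real" and m :: "'v \<Rightarrow> real"
  assumes weight_nonneg: "w x y \<ge> 0"
    and weight_sym: "w x y = w y x"
    and weight_diag: "w x x = 0"
    and measure_pos: "m x > 0"
    and locally_finite: "finite {y. (x, y) \<in> edges w}"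
    and connected: "(x, y) \<in> (edges w)\<^sup>*"

definition gdist :: "('v \<Rightarrow> 'v \<Rightarrow> real) \<Rightarrow> 'v \<Rightarrow> 'v \<Rightarrow> nat" where
  "gdist w x y = Inf {n. (x, y) \<in> edges w ^^ n}"

text \<open>By local finiteness, the sums over all vertices are finite sums over the neighbours.\<close>

definition laplacian :: "('v \<Rightarrow> 'v \<Rightarrow> real) \<Rightarrow> ('v \<Rightarrow> real) \<Rightarrow> ('v \<Rightarrow> real) \<Rightarrow> 'v \<Rightarrow> real" where
  "laplacian w m f x = (1 / m x) * (\<Sum>y | (x, y) \<in> edges w. w x y * (f y - f x))"

definition Deg :: "('v \<Rightarrow> 'v \<Rightarrow> real) \<Rightarrow> ('v \<Rightarrow> real) \<Rightarrow> 'v \<Rightarrow> real" where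
  "Deg w m x = (1 / m x) * (\<Sum>y | (x, y) \<in> edges w. w x y)"

definition finitely_supported :: "('v \<Rightarrow> real) \<Rightarrow> bool" where
  "finitely_supported f \<longleftrightarrow> finite {x. f x \<noteq> 0}"

definition grad :: "('v \<Rightarrow> 'v \<Rightarrow> real) \<Rightarrow> ('v \<Rightarrow> real) \<Rightarrow> 'v \<Rightarrow> 'v \<Rightarrow> real" where
  "grad w f x y = (f x - f y) / real (gdist w x y)"

text \<open>In \<^typ>\<open>ennreal\<close> the supremum is 0 for a graph with a single vertex.\<close>

definition grad_norm :: "('v \<Rightarrow> 'v \<Rightarrow> real) \<Rightarrow> ('v \<Rightarrow> real) \<Rightarrow> ennreal" where
  "grad_norm w f = (SUP (x, y) \<in> {(x, y). x \<noteq> y}. ennreal \<bar>grad w f x y\<bar>)"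

definition Lip1 :: "('v \<Rightarrow> 'v \<Rightarrow> real) \<Rightarrow> ('v \<Rightarrow> real) set" where
  "Lip1 w = {f. \<forall>x y. \<bar>f x - f y\<bar> \<le> real (gdist w x y)}"

text \<open>
  Since the vertex set is discrete, continuity on \<open>V \<times> [0,\<infinity>)\<close> is continuity in time at each
  vertex. The time derivative at 0 is the one-sided one; values at negative times are irrelevant.
\<close>

definition heat_solution ::
  "('v \<Rightarrow> 'v \<Rightarrow> real) \<Rightarrow> ('v \<Rightarrow> real) \<Rightarrow> ('v \<Rightarrow> real) \<Rightarrow> ('v \<Rightarrow> real \<Rightarrow> real) \<Rightarrow> bool" where
  "heat_solution w m f u \<longleftrightarrow>
     (\<forall>x. \<forall>t\<ge>0. 0 \<le> u x t) \<and>
     (\<exists>C. \<forall>x. \<forall>t\<ge>0. u x t \<le> C) \<and>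
     (\<forall>x. continuous_on {0..} (u x)) \<and>
     (\<forall>x. \<forall>t\<ge>0. (u x has_real_derivative laplacian w m (\<lambda>y. u y t) x) (at t within {0..})) \<and>
     (\<forall>x. u x 0 = f x)"

definition smallest_heat_solution ::
  "('v \<Rightarrow> 'v \<Rightarrow> real) \<Rightarrow> ('v \<Rightarrow> real) \<Rightarrow> ('v \<Rightarrow> real) \<Rightarrow> ('v \<Rightarrow> real \<Rightarrow> real) \<Rightarrow> bool" where
  "smallest_heat_solution w m f u \<longleftrightarrow>
     heat_solution w m f u \<and>
     (\<forall>v. heat_solution w m f v \<longrightarrow> (\<forall>x. \<forall>t\<ge>0. u x t \<le> v x t))"

text \<open>The semigroup on non-negative bounded functions, for times \<open>t \<ge> 0\<close>.\<close>

definition heat_nonneg ::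
  "('v \<Rightarrow> 'v \<Rightarrow> real) \<Rightarrow> ('v \<Rightarrow> real) \<Rightarrow> real \<Rightarrow> ('v \<Rightarrow> real) \<Rightarrow> 'v \<Rightarrow> real" where
  "heat_nonneg w m t f x = (THE r. \<exists>u. smallest_heat_solution w m f u \<and> r = u x t)"

text \<open>
  The unique linear extension to all bounded functions is obtained from the decomposition into
  positive and negative part.
\<close>

definition heat ::
  "('v \<Rightarrow> 'v \<Rightarrow> real) \<Rightarrow> ('v \<Rightarrow> real) \<Rightarrow> real \<Rightarrow> ('v \<Rightarrow> real) \<Rightarrow> 'v \<Rightarrow> real" where
  "heat w m t f x =
     heat_nonneg w m t (\<lambda>y. max (f y) 0) x - heat_nonneg w m t (\<lambda>y. max (- f y) 0) x"

definition stochastically_complete :: "('v \<Rightarrow> 'v \<Rightarrow> real) \<Rightarrow> ('v \<Rightarrow> real) \<Rightarrow> bool" where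
  "stochastically_complete w m \<longleftrightarrow> (\<forall>t>0. heat w m t (\<lambda>_. 1) = (\<lambda>_. 1))"

definition heat_kernel ::
  "('v \<Rightarrow> 'v \<Rightarrow> real) \<Rightarrow> ('v \<Rightarrow> real) \<Rightarrow> real \<Rightarrow> 'v \<Rightarrow> 'v \<Rightarrow> real" where
  "heat_kernel w m t x z = m z / m x * heat w m t (indicator {x}) z"

text \<open>
  Probability measures on the countable vertex set are represented by their mass functions;
  for these, the series below converges absolutely since \<open>f\<close> is bounded.
\<close>

definition wasserstein :: "('v \<Rightarrow> 'v \<Rightarrow> real) \<Rightarrow> ('v \<Rightarrow> real) \<Rightarrow> ('v \<Rightarrow> real) \<Rightarrow> ereal" where
  "wasserstein w \<mu> \<nu> =
     (SUP f \<in> {f \<in> Lip1 w. bounded (range f)}. ereal (\<Sum>\<^sub>\<infinity>x. f x * (\<mu> x - \<nu> x)))"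

definition jump_measure ::
  "('v \<Rightarrow> 'v \<Rightarrow> real) \<Rightarrow> ('v \<Rightarrow> real) \<Rightarrow> real \<Rightarrow> 'v \<Rightarrow> 'v \<Rightarrow> real" where
  "jump_measure w m \<epsilon> x y = (if y = x then 1 - \<epsilon> * Deg w m x else \<epsilon> * w x y / m x)"

definition curvature_eps ::
  "('v \<Rightarrow> 'v \<Rightarrow> real) \<Rightarrow> ('v \<Rightarrow> real) \<Rightarrow> real \<Rightarrow> 'v \<Rightarrow> 'v \<Rightarrow> ereal" where
  "curvature_eps w m \<epsilon> x y =
     1 - wasserstein w (jump_measure w m \<epsilon> x) (jump_measure w m \<epsilon> y) / ereal (real (gdist w x y))"

definition curvature :: "('v \<Rightarrow> 'v \<Rightarrow> real) \<Rightarrow> ('v \<Rightarrow> real) \<Rightarrow> 'v \<Rightarrow> 'v \<Rightarrow> ereal" where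
  "curvature w m x y = Lim (at_right 0) (\<lambda>\<epsilon>. ereal (1 / \<epsilon>) * curvature_eps w m \<epsilon> x y)"

definition Ric_ge :: "('v \<Rightarrow> 'v \<Rightarrow> real) \<Rightarrow> ('v \<Rightarrow> real) \<Rightarrow> real \<Rightarrow> bool" where
  "Ric_ge w m K \<longleftrightarrow> (\<forall>x y. x \<noteq> y \<longrightarrow> ereal K \<le> curvature w m x y)"

end

(*
  (1) implies (3) by a maximum principle for u(y,t) - u(x,t) - exp(-Kt) L d(x,y) on V x V x [0,T],
  penalised by a multiple of d(v,x) + d(v,y) + 1: the curvature bound at the pairs (v,z) gives the
  Laplacian comparison for d(v,.), so the penalty makes the maximum attained without being felt
  by the evolution. (2) implies (1) because P_t f = f + t Delta f + O(t^2) at x and y, uniformly over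
  the 1-Lipschitz functions, which may be cut off outside a ball. Under (3), P_t 1 is
  constant in space, hence in time, and stochastic completeness makes bounded solutions unique.
  Uniqueness yields the forward equation and the symmetry of the heat kernel, so p_t^x represents P_t
  at x, and (3) and (4) become dual to each other.
*)

theory Submission
  imports Defs
begin

text \<open>The equation is therefore solved vertex by vertex: the loss term
  \<open>Deg w m x * u x t\<close> goes into a scalar integrating factor, and what remains is a
  neighbour sum, which preserves order. Existence, minimality and passage to limits all rest on this
  integral form. The semigroup is defined through minimal solutions for the positive and the
  negative part, so scaling by a constant and the representation by the kernel are obtained here
  from uniqueness. This is why they come after stochastic completeness, which both (3) and (4)
  supply. No couplings occur: the curvature is used only through dual potentials, for which the
  value after a jump of step size \<epsilon> is affine in \<epsilon>.\<close>

lemma at_within_atLeast_Icc: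
  fixes t :: real
  assumes "0 \<le> t"
  shows "at t within {0..t + 1} = at t within {0..}"
  by (rule at_within_nhd[of _ "{..<t + 1}"]) auto

subsection \<open>Linear scalar equations\<close>

text \<open>Variation of constants for the scalar equation g' = b - D g with g(0) = c. At a single
  vertex the heat equation has this form, with \<open>D\<close> the degree and \<open>b\<close> the
  inflow from the neighbours.\<close>

definition duhamel :: "real \<Rightarrow> real \<Rightarrow> (real \<Rightarrow> real) \<Rightarrow> real \<Rightarrow> real" where
  "duhamel D c b t = exp (- D * t) * (c + integral {0..t} (\<lambda>s. exp (D * s) * b s))"

lemma duhamel_0 [simp]: "duhamel D c b 0 = c"
  by (simp add: duhamel_def)

lemma duhamel_has_derivative:
  assumes b: "continuous_on {0..} b" and t: "0 \<le> t"
  shows "(duhamel D c b has_real_derivative b t - D * duhamel D c b t) (at t within {0..})"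
proof -
  have "continuous_on {0..t + 1} (\<lambda>s. exp (D * s) * b s)"
    by (intro continuous_intros continuous_on_subset[OF b]) auto
  from integral_has_vector_derivative[OF this, of t] t
  have I: "((\<lambda>t. integral {0..t} (\<lambda>s. exp (D * s) * b s)) has_real_derivative
      exp (D * t) * b t) (at t within {0..})"
    by (simp add: has_real_derivative_iff_has_vector_derivative at_within_atLeast_Icc)
  have "((\<lambda>t. exp (- D * t) * (c + integral {0..t} (\<lambda>s. exp (D * s) * b s)))
      has_real_derivative b t - D * duhamel D c b t) (at t within {0..})"
    by (rule derivative_eq_intros I refl)+
      (simp add: duhamel_def algebra_simps flip: exp_add)
  then show ?thesis by (simp add: duhamel_def[abs_def])
qed

text \<open>Only integrability is assumed, because \<open>b\<close> will be a pointwise limit whose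
  continuity is itself derived by means of this lemma.\<close>

lemma continuous_on_duhamel:
  assumes "\<And>t. 0 \<le> t \<Longrightarrow> (\<lambda>s. exp (D * s) * b s) integrable_on {0..t}"
  shows "continuous_on {0..} (duhamel D c b)"
proof -
  have "continuous (at t within {0..}) (duhamel D c b)" if "0 \<le> t" for t
  proof -
    have "continuous_on {0..t + 1} (duhamel D c b)"
      unfolding duhamel_def[abs_def] using assms[of "t + 1"] that
      by (intro continuous_intros indefinite_integral_continuous_1) auto
    then show ?thesis
      using that by (auto simp: continuous_on_eq_continuous_within simp flip: at_within_atLeast_Icc)
  qed
  then show ?thesis by (simp add: continuous_on_eq_continuous_within)
qed

lemma integrable_exp_mult:
  fixes b :: "real \<Rightarrow> real"
  assumes "continuous_on {0..} b"
  shows "(\<lambda>s. exp (D * s) * b s) integrable_on {0..t}"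
  by (intro integrable_continuous_interval continuous_intros continuous_on_subset[OF assms]) auto

text \<open>Integrating factor: exp(D s) g(s) has derivative exp(D s) b(s).\<close>

lemma linear_ode_eq_duhamel:
  assumes g: "\<And>t. 0 \<le> t \<Longrightarrow> (g has_real_derivative b t - D * g t) (at t within {0..})"
    and t: "0 \<le> t"
  shows "g t = duhamel D (g 0) b t"
proof -
  have "((\<lambda>s. exp (D * s) * b s) has_integral exp (D * t) * g t - exp (D * 0) * g 0) {0..t}"
  proof (rule fundamental_theorem_of_calculus[OF t])
    fix s assume s: "s \<in> {0..t}"
    have [derivative_intros]: "(g has_real_derivative b s - D * g s) (at s within {0..t})"
      using g[of s] s by (auto elim: DERIV_subset)
    show "((\<lambda>s. exp (D * s) * g s) has_vector_derivative exp (D * s) * b s) (at s within {0..t})"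
      unfolding has_real_derivative_iff_has_vector_derivative[symmetric]
      by (auto intro!: derivative_eq_intros simp: algebra_simps)
  qed
  then have "integral {0..t} (\<lambda>s. exp (D * s) * b s) = exp (D * t) * g t - g 0"
    by (simp add: integral_unique)
  then show ?thesis by (simp add: duhamel_def algebra_simps flip: exp_add)
qed

lemma duhamel_mono:
  assumes "continuous_on {0..} b" "continuous_on {0..} b'" "c \<le> c'"
    and "\<And>s. 0 \<le> s \<Longrightarrow> b s \<le> b' s"
  shows "duhamel D c b t \<le> duhamel D c' b' t"
  unfolding duhamel_def using assms
  by (intro mult_left_mono add_mono integral_le integrable_exp_mult) auto

text \<open>Constants are stationary for the source \<open>D * c\<close>; together with
  \<open>duhamel_mono\<close> they serve as barriers.\<close>

lemma duhamel_const: "0 \<le> t \<Longrightarrow> duhamel D c (\<lambda>_. D * c) t = c"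
  by (rule linear_ode_eq_duhamel[of "\<lambda>_. c", symmetric]) auto

text \<open>Dominated convergence with majorant exp(D s) B. Integrability is part of the conclusion,
  since \<open>b'\<close> is known only as a pointwise limit.\<close>

lemma duhamel_limit:
  assumes b: "\<And>n. continuous_on {0..} (b n)"
    and bound: "\<And>n s. 0 \<le> s \<Longrightarrow> \<bar>b n s\<bar> \<le> B"
    and lim: "\<And>s. 0 \<le> s \<Longrightarrow> (\<lambda>n. b n s) \<longlonglongrightarrow> b' s"
    and c: "c \<longlonglongrightarrow> c'"
  shows "(\<lambda>s. exp (D * s) * b' s) integrable_on {0..t}"
    and "(\<lambda>n. duhamel D (c n) (b n) t) \<longlonglongrightarrow> duhamel D c' b' t"
proof -
  have B: "(\<lambda>s. exp (D * s) * B) integrable_on {0..t}"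
    by (rule integrable_exp_mult) simp
  have dom: "norm (exp (D * s) * b n s) \<le> exp (D * s) * B" if "s \<in> {0..t}" for n s
    using bound[of s n] that by (simp add: abs_mult)
  have conv: "(\<lambda>n. exp (D * s) * b n s) \<longlonglongrightarrow> exp (D * s) * b' s" if "s \<in> {0..t}" for s
    using lim that by (auto intro!: tendsto_intros)
  note dc = dominated_convergence[OF integrable_exp_mult[OF b] B dom conv]
  show "(\<lambda>s. exp (D * s) * b' s) integrable_on {0..t}" by (rule dc(1))
  show "(\<lambda>n. duhamel D (c n) (b n) t) \<longlonglongrightarrow> duhamel D c' b' t"
    unfolding duhamel_def by (intro tendsto_intros c dc(2))
qed

section \<open>Difference quotients and monotone one-sided limits\<close>

lemma quotient_eq: "d \<noteq> 0 \<Longrightarrow> (1 / e) * (1 - c / d) = (d - c) / e / d" for c d e :: real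
  by (simp add: field_simps)

lemma quotient_linear_eq:
  fixes c d e k :: real
  assumes "d \<noteq> 0" "e \<noteq> 0"
  shows "- ((k - 1) / e) - c / d * e = (1 / e) * (1 - (k * d + c * e\<^sup>2) / d)"
  using assms by (simp add: divide_simps power2_eq_square) (simp add: algebra_simps)

text \<open>By monotonicity each value \<open>g e\<close> is a lower bound for \<open>g\<close> on
  the whole interval from 0 to \<open>e\<close>. A complete order is used so that the limit exists
  in \<open>ereal\<close> without a prior finiteness bound.\<close>

lemma tendsto_at_right_SUP:
  fixes g :: "real \<Rightarrow> 'a :: {complete_linorder, linorder_topology}"
  assumes "\<And>a b. \<lbrakk>0 < a; a \<le> b\<rbrakk> \<Longrightarrow> g b \<le> g a"
  shows "(g \<longlongrightarrow> (SUP e\<in>{0<..}. g e)) (at_right 0)"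
proof (rule order_tendstoI)
  fix a assume "a < (SUP e\<in>{0<..}. g e)"
  then obtain e where e: "0 < e" "a < g e" by (auto simp: less_SUP_iff)
  have "a < g x" if "x \<in> {0<..<e}" for x
    using less_le_trans[OF e(2) assms[of x e]] that by simp
  then show "\<forall>\<^sub>F x in at_right 0. a < g x"
    by (rule eventually_mono[OF eventually_at_right_real[OF e(1)]])
next
  fix a assume "(SUP e\<in>{0<..}. g e) < a"
  then have "g x < a" if "0 < x" for x
    using that by (intro le_less_trans[OF SUP_upper[of x "{0<..}" g]]) auto
  then show "\<forall>\<^sub>F x in at_right 0. g x < a"
    by (rule eventually_mono[OF eventually_at_right_less])
qed

context weighted_graph
begin

subsection \<open>Distance and Laplacian\<close>

lemma edge_iff: "(x, y) \<in> edges w \<longleftrightarrow> w x y > 0"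
  by (simp add: edges_def)

lemma sym_edges: "sym (edges w)"
  by (auto simp: sym_def edges_def weight_sym)

lemma gdist_path: "(x, y) \<in> edges w ^^ gdist w x y"
proof -
  obtain n where "(x, y) \<in> edges w ^^ n"
    using connected[of x y] rtrancl_imp_relpow by blast
  then have "{n. (x, y) \<in> edges w ^^ n} \<noteq> {}" by auto
  from Inf_nat_def1[OF this] show ?thesis by (simp add: gdist_def)
qed

lemma gdist_le: "(x, y) \<in> edges w ^^ n \<Longrightarrow> gdist w x y \<le> n"
  unfolding gdist_def by (rule cInf_lower) auto

lemma gdist_self [simp]: "gdist w x x = 0"
  using gdist_le[of x x 0] by simp

lemma gdist_eq_0_iff [simp]: "gdist w x y = 0 \<longleftrightarrow> x = y"
  using gdist_path[of x y] by (cases "gdist w x y = 0") auto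

lemma gdist_pos: "x \<noteq> y \<Longrightarrow> 0 < gdist w x y"
  using gdist_eq_0_iff by blast

lemma relpow_edges_sym: "(x, y) \<in> edges w ^^ n \<Longrightarrow> (y, x) \<in> edges w ^^ n"
proof (induction n arbitrary: y)
  case (Suc n)
  then obtain z where "(x, z) \<in> edges w ^^ n" "(z, y) \<in> edges w"
    by (auto elim: relpow_Suc_E)
  with Suc.IH symD[OF sym_edges] show ?case by (blast intro: relpow_Suc_I2)
qed simp

lemma gdist_sym: "gdist w x y = gdist w y x"
proof -
  have "gdist w x y \<le> gdist w y x" for x y
    using gdist_path[of y x] relpow_edges_sym gdist_le by blast
  then show ?thesis by (meson le_antisym)
qed

lemma gdist_triangle: "gdist w x z \<le> gdist w x y + gdist w y z"
  using gdist_le relpow_add gdist_path by (metis relcomp.relcompI)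

lemma gdist_edge: "(x, y) \<in> edges w \<Longrightarrow> gdist w x y \<le> 1"
  using gdist_le[of x y 1] by simp

text \<open>The last edge of a shortest path starts in the smaller ball, and each vertex has
  finitely many neighbours. This supplies compactness for the maximum principle and finite support
  for cutoffs.\<close>

lemma finite_gball: "finite {y. gdist w x y \<le> n}"
proof (induction n)
  case (Suc n)
  have "{y. gdist w x y \<le> Suc n} \<subseteq>
      {y. gdist w x y \<le> n} \<union> (\<Union>z\<in>{y. gdist w x y \<le> n}. {y. (z, y) \<in> edges w})"
  proof
    fix y assume "y \<in> {y. gdist w x y \<le> Suc n}"
    then consider "gdist w x y \<le> n" | "gdist w x y = Suc n" by force
    then show "y \<in> {y. gdist w x y \<le> n} \<union>
        (\<Union>z\<in>{y. gdist w x y \<le> n}. {y. (z, y) \<in> edges w})"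
    proof cases
      case 2
      with gdist_path[of x y] obtain z where "(x, z) \<in> edges w ^^ n" "(z, y) \<in> edges w"
        by (auto elim: relpow_Suc_E)
      with gdist_le show ?thesis by blast
    qed auto
  qed
  moreover have "finite \<dots>"
    using Suc locally_finite by auto
  ultimately show ?case by (rule finite_subset)
qed simp

lemma Lip1D: "f \<in> Lip1 w \<Longrightarrow> f x - f y \<le> real (gdist w x y)"
  unfolding Lip1_def by (auto simp: abs_le_iff)

lemma Lip1_gdist: "(\<lambda>y. real (gdist w x y)) \<in> Lip1 w"
proof -
  have "\<bar>real (gdist w x y) - real (gdist w x z)\<bar> \<le> real (gdist w y z)" for y z
    using gdist_triangle[of x y z] gdist_triangle[of x z y] gdist_sym[of y z] by linarith
  then show ?thesis by (auto simp: Lip1_def)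
qed

lemma Lip1_const: "(\<lambda>_. c) \<in> Lip1 w"
  by (simp add: Lip1_def)

lemma Lip1_max:
  assumes "f \<in> Lip1 w" "g \<in> Lip1 w"
  shows "(\<lambda>x. max (f x) (g x)) \<in> Lip1 w"
proof -
  have "\<bar>max (f x) (g x) - max (f y) (g y)\<bar> \<le> real (gdist w x y)" for x y
    using Lip1D[OF assms(1)] Lip1D[OF assms(2)] gdist_sym[of x y] by (smt (verit))
  then show ?thesis by (simp add: Lip1_def)
qed

lemma Lip1_min:
  assumes "f \<in> Lip1 w" "g \<in> Lip1 w"
  shows "(\<lambda>x. min (f x) (g x)) \<in> Lip1 w"
proof -
  have "\<bar>min (f x) (g x) - min (f y) (g y)\<bar> \<le> real (gdist w x y)" for x y
    using Lip1D[OF assms(1)] Lip1D[OF assms(2)] gdist_sym[of x y] by (smt (verit))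
  then show ?thesis by (simp add: Lip1_def)
qed

lemma Lip1_uminus: "f \<in> Lip1 w \<Longrightarrow> (\<lambda>x. - f x) \<in> Lip1 w"
  unfolding Lip1_def by (auto simp: abs_minus_commute)

lemma Lip1_diff_const: "f \<in> Lip1 w \<Longrightarrow> (\<lambda>x. f x - c) \<in> Lip1 w"
  unfolding Lip1_def by auto

text \<open>The order-preserving part of the Laplacian. Splitting it off isolates the value at
  \<open>x\<close> itself, which carries the negative sign.\<close>

definition inflow :: "('v \<Rightarrow> real) \<Rightarrow> 'v \<Rightarrow> real" where
  "inflow f x = (\<Sum>y | (x, y) \<in> edges w. w x y * f y) / m x"

lemma laplacian_inflow: "laplacian w m f x = inflow f x - Deg w m x * f x"
  by (simp add: laplacian_def inflow_def Deg_def right_diff_distrib sum_subtractf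
      sum_distrib_right diff_divide_distrib)

lemma inflow_const: "inflow (\<lambda>_. c) x = Deg w m x * c"
  by (simp add: inflow_def Deg_def sum_distrib_right)

lemma Deg_nonneg: "0 \<le> Deg w m x"
  unfolding Deg_def
  by (simp add: sum_nonneg weight_nonneg less_imp_le[OF measure_pos])

lemma inflow_mono:
  "(\<And>y. (x, y) \<in> edges w \<Longrightarrow> f y \<le> g y) \<Longrightarrow> inflow f x \<le> inflow g x"
  unfolding inflow_def
  by (intro divide_right_mono sum_mono mult_left_mono weight_nonneg less_imp_le[OF measure_pos])
    simp

lemma inflow_cong:
  "(\<And>y. (x, y) \<in> edges w \<Longrightarrow> f y = g y) \<Longrightarrow> inflow f x = inflow g x"
  unfolding inflow_def by (auto intro!: sum.cong)

lemma inflow_add: "inflow (\<lambda>y. f y + g y) x = inflow f x + inflow g x"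
  by (simp add: inflow_def distrib_left sum.distrib add_divide_distrib)

lemma inflow_cmult: "inflow (\<lambda>y. c * f y) x = c * inflow f x"
  by (simp add: inflow_def sum_distrib_left mult.left_commute)

lemma abs_inflow_le:
  assumes "\<And>y. (x, y) \<in> edges w \<Longrightarrow> \<bar>f y\<bar> \<le> C"
  shows "\<bar>inflow f x\<bar> \<le> Deg w m x * C"
proof -
  have "inflow f x \<le> inflow (\<lambda>_. C) x" "inflow (\<lambda>_. - C) x \<le> inflow f x"
    using assms by (force intro!: inflow_mono simp: abs_le_iff minus_le_iff)+
  then show ?thesis unfolding inflow_const by simp
qed

lemma tendsto_inflow:
  assumes "\<And>y. (x, y) \<in> edges w \<Longrightarrow> ((\<lambda>n. f n y) \<longlongrightarrow> g y) F"
  shows "((\<lambda>n. inflow (f n) x) \<longlongrightarrow> inflow g x) F"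
  unfolding inflow_def divide_inverse using assms by (auto intro!: tendsto_intros)

lemma continuous_on_inflow:
  assumes "\<And>y. (x, y) \<in> edges w \<Longrightarrow> continuous_on S (u y)"
  shows "continuous_on S (\<lambda>s. inflow (\<lambda>y. u y s) x)"
  unfolding inflow_def divide_inverse using assms by (auto intro!: continuous_intros)

lemma laplacian_const [simp]: "laplacian w m (\<lambda>_. c) x = 0"
  by (simp add: laplacian_def)

lemma laplacian_add:
  "laplacian w m (\<lambda>y. f y + g y) x = laplacian w m f x + laplacian w m g x"
  by (simp add: laplacian_inflow inflow_add algebra_simps)

lemma laplacian_cmult: "laplacian w m (\<lambda>y. c * f y) x = c * laplacian w m f x"
  by (simp add: laplacian_inflow inflow_cmult algebra_simps)

lemma laplacian_uminus: "laplacian w m (\<lambda>y. - f y) x = - laplacian w m f x"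
  using laplacian_cmult[of "-1"] by simp

lemma laplacian_diff:
  "laplacian w m (\<lambda>y. f y - g y) x = laplacian w m f x - laplacian w m g x"
  using laplacian_add[of f "\<lambda>y. - g y"] by (simp add: laplacian_uminus)

lemma laplacian_cong:
  "\<lbrakk>\<And>y. (x, y) \<in> edges w \<Longrightarrow> f y = g y; f x = g x\<rbrakk> \<Longrightarrow>
    laplacian w m f x = laplacian w m g x"
  by (simp add: laplacian_inflow cong: inflow_cong)

text \<open>The terms at \<open>x\<close> agree, so only the neighbours are compared: the discrete
  form of the second-order condition at a contact point.\<close>

lemma laplacian_mono_touching:
  "\<lbrakk>\<And>y. f y \<le> g y; f x = g x\<rbrakk> \<Longrightarrow> laplacian w m f x \<le> laplacian w m g x"
  by (simp add: laplacian_inflow inflow_mono)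

lemma abs_laplacian_le:
  assumes "\<And>y. (x, y) \<in> edges w \<Longrightarrow> \<bar>f y\<bar> \<le> C" "\<bar>f x\<bar> \<le> C"
  shows "\<bar>laplacian w m f x\<bar> \<le> 2 * Deg w m x * C"
proof -
  have "\<bar>inflow f x\<bar> \<le> Deg w m x * C"
    using assms(1) by (rule abs_inflow_le)
  moreover have "\<bar>Deg w m x * f x\<bar> \<le> Deg w m x * C"
    using mult_left_mono[OF assms(2) Deg_nonneg[of x]] by (simp add: abs_mult Deg_nonneg)
  ultimately show ?thesis unfolding laplacian_inflow by linarith
qed

lemma abs_laplacian_Lip1:
  assumes "f \<in> Lip1 w"
  shows "\<bar>laplacian w m f x\<bar> \<le> Deg w m x"
proof -
  have "laplacian w m f x = inflow (\<lambda>y. f y - f x) x"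
    by (simp add: laplacian_def inflow_def)
  moreover have "\<bar>f y - f x\<bar> \<le> 1" if "(x, y) \<in> edges w" for y
    using assms gdist_edge[OF that] gdist_sym[of x y] unfolding Lip1_def
    by (smt (verit) mem_Collect_eq of_nat_1 of_nat_mono)
  ultimately show ?thesis using abs_inflow_le[of x "\<lambda>y. f y - f x" 1] by simp
qed

subsection \<open>Minimal solutions of the heat equation\<close>

text \<open>Sign, boundedness and initial value are left out of \<open>heat_solution\<close>, so
  that solutions form a vector space and minimality can be tested against unbounded ones.\<close>

definition solves_heat :: "('v \<Rightarrow> real \<Rightarrow> real) \<Rightarrow> bool" where
  "solves_heat u \<longleftrightarrow>
    (\<forall>x. \<forall>t\<ge>0. (u x has_real_derivative laplacian w m (\<lambda>y. u y t) x) (at t within {0..}))"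

lemma solves_heat_continuous: "solves_heat u \<Longrightarrow> continuous_on {0..} (u x)"
  unfolding solves_heat_def by (rule DERIV_continuous_on) auto

lemma solves_heat_eq_duhamel:
  assumes "solves_heat u" "0 \<le> t"
  shows "u x t = duhamel (Deg w m x) (u x 0) (\<lambda>s. inflow (\<lambda>y. u y s) x) t"
  using assms by (intro linear_ode_eq_duhamel) (auto simp: solves_heat_def laplacian_inflow)

text \<open>
  Taking \<open>v n = u (Suc n)\<close> covers Picard iterations, and \<open>v n = u n\<close> limits of solutions.
\<close>

lemma solves_heat_limit:
  assumes u: "\<And>n x. continuous_on {0..} (u n x)"
    and bound: "\<And>n x t. 0 \<le> t \<Longrightarrow> \<bar>u n x t\<bar> \<le> C"
    and lim: "\<And>x t. 0 \<le> t \<Longrightarrow> (\<lambda>n. u n x t) \<longlonglongrightarrow> U x t"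
    and v: "\<And>n x t. 0 \<le> t \<Longrightarrow>
      v n x t = duhamel (Deg w m x) (f n x) (\<lambda>s. inflow (\<lambda>y. u n y s) x) t"
    and vlim: "\<And>x t. 0 \<le> t \<Longrightarrow> (\<lambda>n. v n x t) \<longlonglongrightarrow> U x t"
    and f: "\<And>x. (\<lambda>n. f n x) \<longlonglongrightarrow> g x"
  shows "solves_heat U" and "U x 0 = g x"
proof -
  let ?b = "\<lambda>x s. inflow (\<lambda>y. U y s) x"
  have *: "(\<lambda>s. exp (Deg w m x * s) * ?b x s) integrable_on {0..t}"
    "(\<lambda>n. duhamel (Deg w m x) (f n x) (\<lambda>s. inflow (\<lambda>y. u n y s) x) t)
      \<longlonglongrightarrow> duhamel (Deg w m x) (g x) (?b x) t" for x t
    by (rule duhamel_limit[where B = "Deg w m x * C"];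
        auto intro!: continuous_on_inflow u abs_inflow_le bound tendsto_inflow lim f)+
  have U: "U x t = duhamel (Deg w m x) (g x) (?b x) t" if "0 \<le> t" for x t
    using *(2)[of x t] vlim[OF that, of x] v[OF that] by (simp add: LIMSEQ_unique)
  \<comment> \<open>So far \<open>U\<close> is only a pointwise limit. The integral equation makes
    it continuous, hence also its inflow, and then the integral is differentiable.\<close>
  have "continuous_on {0..} (U x)" for x
    using continuous_on_duhamel[OF *(1), of x "g x"] by (rule continuous_on_eq) (simp add: U)
  then have cont: "continuous_on {0..} (?b x)" for x
    by (intro continuous_on_inflow)
  show "solves_heat U"
    unfolding solves_heat_def
  proof (intro allI impI)
    fix x and t :: real assume t: "0 \<le> t"
    have "(duhamel (Deg w m x) (g x) (?b x) has_real_derivative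
        laplacian w m (\<lambda>y. U y t) x) (at t within {0..})"
      using duhamel_has_derivative[OF cont t, of "Deg w m x" "g x" x] U[OF t, of x]
      by (simp add: laplacian_inflow)
    then show "(U x has_real_derivative laplacian w m (\<lambda>y. U y t) x) (at t within {0..})"
      by (rule has_field_derivative_transform_within[where d = 1])
        (use t U in \<open>auto simp: dist_real_def\<close>)
  qed
  show "U x 0 = g x" using U[of 0 x] by simp
qed

text \<open>The start at 0 makes the iterates increase for nonnegative \<open>f\<close>, towards the
  minimal solution. In terms of the jump process, iterate \<open>n\<close> counts only paths with
  fewer than \<open>n\<close> jumps.\<close>

primrec picard :: "('v \<Rightarrow> real) \<Rightarrow> nat \<Rightarrow> 'v \<Rightarrow> real \<Rightarrow> real" where
  "picard f 0 = (\<lambda>x t. 0)"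
| "picard f (Suc n) =
    (\<lambda>x t. duhamel (Deg w m x) (f x) (\<lambda>s. inflow (\<lambda>y. picard f n y s) x) t)"

lemma continuous_on_picard: "continuous_on {0..} (picard f n x)"
proof (induction n arbitrary: x)
  case (Suc n)
  then show ?case
    by (auto intro!: continuous_on_duhamel integrable_exp_mult continuous_on_inflow)
qed simp

lemma picard_Suc_mono:
  assumes "\<And>x. 0 \<le> f x" "0 \<le> t"
  shows "picard f n x t \<le> picard f (Suc n) x t"
  using assms(2)
proof (induction n arbitrary: x t)
  case 0
  then show ?case
    using assms(1) duhamel_mono[of "\<lambda>_. 0" "\<lambda>_. 0" 0 "f x" "Deg w m x" t] duhamel_const[of t _ 0]
    by (simp add: inflow_const)
next
  case (Suc n)
  show ?case
    unfolding picard.simps(2)[of f "Suc n"] unfolding picard.simps(2)[of f n]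
    using Suc assms(1) continuous_on_picard[of f n] continuous_on_picard[of f "Suc n"]
    by (intro duhamel_mono continuous_on_inflow inflow_mono) auto
qed

text \<open>A solution is a fixed point of the same monotone Duhamel map, so it stays above all
  iterates once it is above the zero start. An inequality at time 0 suffices, which admits constants
  as upper barriers.\<close>

lemma picard_le_solution:
  assumes v: "solves_heat v" "\<And>x t. 0 \<le> t \<Longrightarrow> 0 \<le> v x t"
    and init: "\<And>x. f x \<le> v x 0" and t: "0 \<le> t"
  shows "picard f n x t \<le> v x t"
  using t
proof (induction n arbitrary: x t)
  case (Suc n)
  have "picard f (Suc n) x t \<le>
      duhamel (Deg w m x) (v x 0) (\<lambda>s. inflow (\<lambda>y. v y s) x) t"
    unfolding picard.simps(2) using Suc
    by (intro duhamel_mono continuous_on_inflow inflow_mono continuous_on_picard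
        solves_heat_continuous[OF v(1)] init)
  then show ?case using solves_heat_eq_duhamel[OF v(1) Suc.prems] by simp
qed (use v in auto)

text \<open>Minimality holds even among unbounded solutions; the heat kernel symmetry needs this.\<close>

lemma exists_minimal_solution:
  assumes f: "\<And>x. 0 \<le> f x" "\<And>x. f x \<le> C"
  shows "\<exists>u. smallest_heat_solution w m f u \<and> (\<forall>x. \<forall>t\<ge>0. u x t \<le> C) \<and>
    (\<forall>v. solves_heat v \<longrightarrow> (\<forall>x. \<forall>t\<ge>0. 0 \<le> v x t) \<longrightarrow> (\<forall>x. v x 0 = f x) \<longrightarrow>
      (\<forall>x. \<forall>t\<ge>0. u x t \<le> v x t))"
proof -
  define u where "u x t = lim (\<lambda>n. picard f n x t)" for x t
  have C: "0 \<le> C" using f[of undefined] by linarith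
  have inc: "incseq (\<lambda>n. picard f n x t)" if "0 \<le> t" for x t
    using picard_Suc_mono[OF f(1) that] by (rule incseq_SucI)
  have nonneg: "0 \<le> picard f n x t" if "0 \<le> t" for n x t
    using incseqD[OF inc[OF that, of x], of 0 n] by simp
  \<comment> \<open>The constant \<open>C\<close> solves the equation and lies above
    \<open>f\<close>.\<close>
  have le: "picard f n x t \<le> C" if "0 \<le> t" for n x t
    using that f(2) C by (intro picard_le_solution[of "\<lambda>_ _. C"]) (auto simp: solves_heat_def)
  have lim: "(\<lambda>n. picard f n x t) \<longlonglongrightarrow> u x t" if "0 \<le> t" for x t
    unfolding u_def by (rule incseq_convergent[OF inc[OF that, of x], of C]) (auto simp: le that limI)
  note sol = solves_heat_limit[of "picard f" C u "\<lambda>n. picard f (Suc n)" "\<lambda>_. f" f,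
      OF continuous_on_picard _ lim picard.simps(2)[THEN fun_cong, THEN fun_cong]
        LIMSEQ_Suc[OF lim] tendsto_const]
  have bound: "\<bar>picard f n x t\<bar> \<le> C" if "0 \<le> t" for n x t
    using nonneg[OF that] le[OF that] by simp
  have solves: "solves_heat u" and init: "u x 0 = f x" for x
    by (rule sol; use bound in blast)+
  have u0: "0 \<le> u x t" and uC: "u x t \<le> C" if "0 \<le> t" for x t
    using LIMSEQ_le_const[OF lim[OF that]] LIMSEQ_le_const2[OF lim[OF that]] nonneg le that
    by blast+
  have min: "u x t \<le> v x t"
    if "solves_heat v" "\<And>x t. 0 \<le> t \<Longrightarrow> 0 \<le> v x t" "\<And>x. v x 0 = f x" "0 \<le> t" for v x t
    using LIMSEQ_le_const2[OF lim[OF that(4)]] picard_le_solution[OF that(1,2)] that(3,4) by simp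
  have "heat_solution w m f u"
    unfolding heat_solution_def using solves[unfolded solves_heat_def]
    by (intro conjI exI[of _ C] allI impI u0 uC init solves_heat_continuous[OF solves]) auto
  moreover have "u x t \<le> v x t" if "heat_solution w m f v" "0 \<le> t" for v x t
    using min[of v] that by (auto simp: heat_solution_def solves_heat_def)
  ultimately have "smallest_heat_solution w m f u"
    by (simp add: smallest_heat_solution_def)
  then show ?thesis by (intro exI[of _ u] conjI allI impI) (simp_all add: uC min)
qed

lemma smallest_heat_solutionD:
  assumes "smallest_heat_solution w m f u"
  shows "solves_heat u" "0 \<le> t \<Longrightarrow> 0 \<le> u x t" "u x 0 = f x"
  using assms by (simp_all add: smallest_heat_solution_def heat_solution_def solves_heat_def)

section \<open>The semigroup and its solutions\<close>

lemma heat_nonneg_eq: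
  assumes u: "smallest_heat_solution w m f u" and t: "0 \<le> t"
  shows "heat_nonneg w m t f x = u x t"
  unfolding heat_nonneg_def
proof (rule the_equality)
  fix r assume "\<exists>v. smallest_heat_solution w m f v \<and> r = v x t"
  then obtain v where v: "smallest_heat_solution w m f v" "r = v x t" by blast
  with u t show "r = u x t"
    unfolding smallest_heat_solution_def by (meson order_antisym)
qed (use u in blast)

lemma solves_heat_cong:
  assumes u: "solves_heat u" and eq: "\<And>x t. 0 \<le> t \<Longrightarrow> v x t = u x t"
  shows "solves_heat v"
  unfolding solves_heat_def
proof (intro allI impI)
  fix x and t :: real assume t: "0 \<le> t"
  have "(u x has_real_derivative laplacian w m (\<lambda>y. v y t) x) (at t within {0..})"
    using u t eq by (simp add: solves_heat_def)
  then show "(v x has_real_derivative laplacian w m (\<lambda>y. v y t) x) (at t within {0..})"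
    by (rule has_field_derivative_transform_within[where d = 1]) (use t eq in auto)
qed

lemma solves_heat_const: "solves_heat (\<lambda>_ _. c)"
  by (simp add: solves_heat_def)

lemma solves_heat_add:
  "solves_heat u \<Longrightarrow> solves_heat v \<Longrightarrow> solves_heat (\<lambda>x t. u x t + v x t)"
  unfolding solves_heat_def laplacian_add by (auto intro!: derivative_intros)

lemma solves_heat_cmult: "solves_heat u \<Longrightarrow> solves_heat (\<lambda>x t. c * u x t)"
  unfolding solves_heat_def laplacian_cmult by (auto intro!: derivative_eq_intros)

lemma solves_heat_diff:
  "solves_heat u \<Longrightarrow> solves_heat v \<Longrightarrow> solves_heat (\<lambda>x t. u x t - v x t)"
  using solves_heat_add[of u "\<lambda>x t. - 1 * v x t"] solves_heat_cmult[of v "- 1"] by simp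

lemma solves_heat_sum:
  "(\<And>i. i \<in> I \<Longrightarrow> solves_heat (u i)) \<Longrightarrow> solves_heat (\<lambda>x t. \<Sum>i\<in>I. c i * u i x t)"
proof (induction I rule: infinite_finite_induct)
  case (insert i I)
  then show ?case
    using solves_heat_add[OF solves_heat_cmult[of "u i" "c i"] insert.IH] by simp
qed (simp_all add: solves_heat_const)

text \<open>Both parts of \<open>f\<close> lie between 0 and \<open>C\<close>, hence so do their
  minimal solutions, and the difference of two such numbers is at most \<open>C\<close> in absolute
  value.\<close>

lemma heat_exists:
  assumes "\<And>x. \<bar>f x\<bar> \<le> C"
  shows "\<exists>u. solves_heat u \<and> (\<forall>x. \<forall>t\<ge>0. \<bar>u x t\<bar> \<le> C) \<and> (\<forall>x. u x 0 = f x) \<and>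
    (\<forall>x. \<forall>t\<ge>0. heat w m t f x = u x t)"
proof -
  have C: "max (f x) 0 \<le> C" "max (- f x) 0 \<le> C" for x
    using assms[of x] by auto
  obtain u where u: "smallest_heat_solution w m (\<lambda>x. max (f x) 0) u"
      "\<And>x t. 0 \<le> t \<Longrightarrow> u x t \<le> C"
    using exists_minimal_solution[of "\<lambda>x. max (f x) 0" C] C(1) by auto
  obtain v where v: "smallest_heat_solution w m (\<lambda>x. max (- f x) 0) v"
      "\<And>x t. 0 \<le> t \<Longrightarrow> v x t \<le> C"
    using exists_minimal_solution[of "\<lambda>x. max (- f x) 0" C] C(2) by auto
  note hu = smallest_heat_solutionD[OF u(1)] and hv = smallest_heat_solutionD[OF v(1)]
  show ?thesis
  proof (intro exI[of _ "\<lambda>x t. u x t - v x t"] conjI allI impI)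
    show "solves_heat (\<lambda>x t. u x t - v x t)"
      using hu(1) hv(1) by (rule solves_heat_diff)
    show "\<bar>u x t - v x t\<bar> \<le> C" if "0 \<le> t" for x t
      using hu(2)[OF that, of x] hv(2)[OF that, of x] u(2)[OF that, of x] v(2)[OF that, of x]
      by linarith
    show "u x 0 - v x 0 = f x" for x
      by (simp add: hu(3) hv(3) max_def)
    show "heat w m t f x = u x t - v x t" if "0 \<le> t" for x t
      using that by (simp add: heat_def heat_nonneg_eq[OF u(1)] heat_nonneg_eq[OF v(1)])
  qed
qed

lemma bounded_range_iff: "bounded (range f) \<longleftrightarrow> (\<exists>C. \<forall>x. \<bar>f x :: real\<bar> \<le> C)"
  by (simp add: bounded_iff)

lemma abs_heat_le:
  assumes "\<And>x. \<bar>f x\<bar> \<le> C" "0 \<le> t"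
  shows "\<bar>heat w m t f x\<bar> \<le> C"
  using heat_exists[of f C] assms by auto

lemma
  assumes "bounded (range f)"
  shows heat_solves: "solves_heat (\<lambda>x t. heat w m t f x)"
    and heat_0: "heat w m 0 f x = f x"
proof -
  obtain C where "\<And>x. \<bar>f x\<bar> \<le> C"
    using assms unfolding bounded_range_iff by blast
  from heat_exists[of f C, OF this] obtain u where u: "solves_heat u" "\<forall>x. u x 0 = f x"
    "\<forall>x. \<forall>t\<ge>0. heat w m t f x = u x t"
    by blast
  show "solves_heat (\<lambda>x t. heat w m t f x)"
    by (rule solves_heat_cong[OF u(1)]) (simp add: u(3))
  show "heat w m 0 f x = f x" by (simp add: u)
qed

lemma heat_of_nonneg:
  assumes f: "\<And>x. 0 \<le> f x" "bounded (range f)"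
  shows "0 \<le> t \<Longrightarrow> 0 \<le> heat w m t f x"
    and "\<lbrakk>solves_heat v; \<And>x t. 0 \<le> t \<Longrightarrow> 0 \<le> v x t; \<And>x. v x 0 = f x; 0 \<le> t\<rbrakk> \<Longrightarrow>
      heat w m t f x \<le> v x t"
proof -
  obtain C where C: "f x \<le> C" for x
    using f(2) unfolding bounded_range_iff by (meson abs_le_D1)
  obtain u where u: "smallest_heat_solution w m f u"
    "\<forall>v. solves_heat v \<longrightarrow> (\<forall>x. \<forall>t\<ge>0. 0 \<le> v x t) \<longrightarrow> (\<forall>x. v x 0 = f x) \<longrightarrow>
      (\<forall>x. \<forall>t\<ge>0. u x t \<le> v x t)"
    using exists_minimal_solution[of f C] f(1) C by blast
  \<comment> \<open>The negative part of \<open>f\<close> is 0 and evolves to 0, so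
    \<open>heat\<close> agrees with the minimal solution.\<close>
  have z: "smallest_heat_solution w m (\<lambda>_. 0) (\<lambda>_ _. 0)"
    unfolding smallest_heat_solution_def heat_solution_def by (auto intro: exI[of _ 0])
  have *: "heat w m t f x = u x t" if "0 \<le> t" for t x
    using that f(1)
    by (simp add: heat_def heat_nonneg_eq[OF u(1)] heat_nonneg_eq[OF z] max_absorb1 max_absorb2)
  show "0 \<le> heat w m t f x" if "0 \<le> t" for t x
    using smallest_heat_solutionD(2)[OF u(1) that] that by (simp add: *)
  show "heat w m t f x \<le> v x t"
    if "solves_heat v" "\<And>x t. 0 \<le> t \<Longrightarrow> 0 \<le> v x t" "\<And>x. v x 0 = f x" "0 \<le> t"
    using that u(2)[rule_format, of v t x] by (simp add: *)
qed

lemma bounded_indicator: "bounded (range (indicator A :: 'v \<Rightarrow> real))"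
  unfolding bounded_range_iff by (intro exI[of _ 1]) (simp add: indicator_def)

lemma DERIV_laplacian:
  assumes "\<And>y. (u y has_real_derivative u' y) (at t within S)"
  shows "((\<lambda>s. laplacian w m (\<lambda>y. u y s) x) has_real_derivative laplacian w m u' x)
    (at t within S)"
  unfolding laplacian_def by (intro DERIV_cmult DERIV_sum DERIV_diff assms)

subsection \<open>Stochastic completeness and the heat kernel\<close>

lemma stochastically_complete_heat_1:
  assumes "stochastically_complete w m" "0 \<le> t"
  shows "heat w m t (\<lambda>_. 1) x = 1"
  using assms heat_0[of "\<lambda>_. 1"] unfolding stochastically_complete_def
  by (cases "t = 0") (auto dest: fun_cong)

text \<open>After scaling, 1 + u / K is a nonnegative solution starting from 1, so it dominates the
  minimal one, which is 1.\<close>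

lemma bounded_solution_nonneg:
  assumes sc: "stochastically_complete w m"
    and u: "solves_heat u" "\<And>x t. 0 \<le> t \<Longrightarrow> \<bar>u x t\<bar> \<le> C" "\<And>x. u x 0 = 0" and t: "0 \<le> t"
  shows "0 \<le> u x t"
proof -
  define K where "K = max C 1"
  have K: "0 < K" by (simp add: K_def)
  have "heat w m t (\<lambda>_. 1) x \<le> 1 + (1 / K) * u x t"
  proof (rule heat_of_nonneg(2)[where v = "\<lambda>x t. 1 + (1 / K) * u x t"])
    show "solves_heat (\<lambda>x t. 1 + (1 / K) * u x t)"
      by (intro solves_heat_add solves_heat_const solves_heat_cmult u)
    show "0 \<le> 1 + (1 / K) * u x t" if "0 \<le> t" for x t
      using u(2)[OF that, of x] K by (auto simp: field_simps K_def)
  qed (use u t in auto)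
  then show ?thesis
    using K t by (simp add: stochastically_complete_heat_1[OF sc] zero_le_divide_iff)
qed

lemma heat_unique:
  assumes sc: "stochastically_complete w m"
    and u: "solves_heat u" "\<And>x t. 0 \<le> t \<Longrightarrow> \<bar>u x t\<bar> \<le> C" "\<And>x. u x 0 = f x" and t: "0 \<le> t"
  shows "heat w m t f x = u x t"
proof -
  have f: "\<bar>f x\<bar> \<le> C" for x
    using u(2)[of 0 x] u(3) by simp
  then have bf: "bounded (range f)" unfolding bounded_range_iff by blast
  have hb: "\<bar>heat w m t f x\<bar> \<le> C" if "0 \<le> t" for x t
    using f that by (rule abs_heat_le)
  have 1: "0 \<le> heat w m t f x - u x t"
  proof (rule bounded_solution_nonneg[OF sc _ _ _ t])
    show "solves_heat (\<lambda>x t. heat w m t f x - u x t)"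
      by (rule solves_heat_diff[OF heat_solves[OF bf] u(1)])
    show "\<bar>heat w m t f x - u x t\<bar> \<le> 2 * C" if "0 \<le> t" for x t
      using u(2)[OF that, of x] hb[OF that, of x] by linarith
  qed (simp add: heat_0[OF bf] u(3))
  have 2: "0 \<le> u x t - heat w m t f x"
  proof (rule bounded_solution_nonneg[OF sc _ _ _ t])
    show "solves_heat (\<lambda>x t. u x t - heat w m t f x)"
      by (rule solves_heat_diff[OF u(1) heat_solves[OF bf]])
    show "\<bar>u x t - heat w m t f x\<bar> \<le> 2 * C" if "0 \<le> t" for x t
      using u(2)[OF that, of x] hb[OF that, of x] by linarith
  qed (simp add: heat_0[OF bf] u(3))
  from 1 2 show ?thesis by simp
qed

text \<open>Covers the degenerate case in which the barrier constant of the forward equation would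
  divide by 0.\<close>

lemma edges_empty_if_Deg_0:
  assumes "Deg w m x = 0"
  shows "{y. (x, y) \<in> edges w} = {}"
proof (rule ccontr)
  assume "{y. (x, y) \<in> edges w} \<noteq> {}"
  then have "0 < (\<Sum>y | (x, y) \<in> edges w. w x y)"
    by (intro sum_pos locally_finite) (auto simp: edge_iff)
  with assms measure_pos[of x] show False by (simp add: Deg_def)
qed

text \<open>
  The right-hand side of the forward equation is a linear combination of solutions; solving it for
  \<open>h\<close> by variation of constants gives a function whose defect \<open>e\<close> from the heat equation decays
  exponentially from \<open>0\<close>, so \<open>h\<close> is a bounded solution and uniqueness applies.
\<close>

lemma heat_indicator_forward:
  assumes sc: "stochastically_complete w m" and t: "0 \<le> t"
  shows "((\<lambda>t. heat w m t (indicator {x}) z) has_real_derivative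
    (\<Sum>y | (x, y) \<in> edges w. w x y / m y * heat w m t (indicator {y}) z)
      - Deg w m x * heat w m t (indicator {x}) z) (at t within {0..})"
proof -
  define D where "D = Deg w m x"
  define B where "B z s = (\<Sum>y | (x, y) \<in> edges w. w x y / m y * heat w m s (indicator {y}) z)" for z s
  define h where "h z = duhamel D (indicator {x} z) (B z)" for z
  have solB: "solves_heat B"
    unfolding B_def[abs_def] by (intro solves_heat_sum heat_solves bounded_indicator)
  have contB: "continuous_on {0..} (B z)" for z
    using solB by (rule solves_heat_continuous)
  have h': "(h z has_real_derivative B z t - D * h z t) (at t within {0..})" if "0 \<le> t" for z t
    unfolding h_def using contB that by (rule duhamel_has_derivative)
  define e where "e z t = laplacian w m (\<lambda>y. h y t) z - B z t + D * h z t" for z t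
  \<comment> \<open>The Laplacian of \<open>B\<close> enters twice with opposite signs, because
    \<open>B\<close> solves the heat equation; the rest is - D times \<open>e\<close>.\<close>
  have e': "(e z has_real_derivative 0 - D * e z t) (at t within {0..})" if "0 \<le> t" for z t
  proof -
    have lap: "((\<lambda>t. laplacian w m (\<lambda>y. h y t) z) has_real_derivative
        laplacian w m (\<lambda>z. B z t) z - D * laplacian w m (\<lambda>y. h y t) z) (at t within {0..})"
      using DERIV_laplacian[OF h'[OF that]] by (simp add: laplacian_diff laplacian_cmult)
    have B': "(B z has_real_derivative laplacian w m (\<lambda>z. B z t) z) (at t within {0..})"
      using solB that by (simp add: solves_heat_def)
    show ?thesis
      unfolding e_def[abs_def]
      by (rule derivative_eq_intros lap B' h' that refl)+ (simp add: algebra_simps)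
  qed
  \<comment> \<open>The forward and the backward generator agree on the initial indicator: at
    \<open>x\<close> both give - D, and elsewhere symmetry of \<open>w\<close> equates them.\<close>
  have e0: "e z 0 = 0" for z
  proof -
    have "B z 0 = (\<Sum>y | (x, y) \<in> edges w. if z = y then w x y / m y else 0)"
      unfolding B_def by (intro sum.cong) (auto simp: heat_0 bounded_indicator)
    also have "\<dots> = (if (x, z) \<in> edges w then w x z / m z else 0)"
      by (simp add: locally_finite)
    finally have "B z 0 = (if (x, z) \<in> edges w then w x z / m z else 0)" .
    moreover have "inflow (indicator {x}) z =
        (\<Sum>y | (z, y) \<in> edges w. if x = y then w z y else 0) / m z"
      unfolding inflow_def by (intro arg_cong2[where f = "(/)"] sum.cong) auto
    then have "inflow (indicator {x}) z = (if (z, x) \<in> edges w then w z x / m z else 0)"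
      by (simp add: locally_finite)
    moreover have "(z, x) \<in> edges w \<longleftrightarrow> (x, z) \<in> edges w"
      by (simp add: edge_iff weight_sym)
    ultimately show ?thesis
      by (cases "z = x") (simp_all add: e_def h_def laplacian_inflow D_def weight_sym[of z x])
  qed
  have "laplacian w m (\<lambda>y. h y t) z = B z t - D * h z t" if "0 \<le> t" for z t
  proof -
    have "e z t = 0"
      using linear_ode_eq_duhamel[of "e z" "\<lambda>_. 0" D t] e' e0 that by (simp add: duhamel_def)
    then show ?thesis unfolding e_def by linarith
  qed
  then have solh: "solves_heat h"
    unfolding solves_heat_def using h' by simp
  define b where "b = (\<Sum>y | (x, y) \<in> edges w. w x y / m y)"
  \<comment> \<open>The 1 dominates the initial indicator, and b / D makes \<open>D * C\<close>
    dominate the source, so the constant \<open>C\<close> is a barrier for \<open>h\<close>.\<close>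
  define C where "C = max 1 (b / D)"
  have p: "0 \<le> heat w m t (indicator {y}) z" "heat w m t (indicator {y}) z \<le> 1"
    if "0 \<le> t" for y z t
    using heat_of_nonneg(1)[OF _ bounded_indicator that, of "{y}" z]
      abs_heat_le[of "indicator {y}" 1 t z] that by (auto simp: indicator_def)
  have c: "0 \<le> w x y / m y" for y
    by (simp add: weight_nonneg less_imp_le[OF measure_pos])
  have B: "0 \<le> B z t" "B z t \<le> b" if "0 \<le> t" for z t
    unfolding B_def b_def
    by (intro sum_nonneg mult_nonneg_nonneg sum_mono mult_left_le c p[OF that])+
  have bD: "b \<le> D * C"
  proof (cases "D = 0")
    case True
    then show ?thesis using edges_empty_if_Deg_0[of x] by (simp add: D_def b_def)
  next
    case False
    then have "0 < D" using Deg_nonneg[of x] by (simp add: D_def)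
    then show ?thesis by (simp add: C_def field_simps max_def)
  qed
  have hb: "\<bar>h z t\<bar> \<le> C" if "0 \<le> t" for z t
  proof -
    have "h z t \<le> duhamel D C (\<lambda>_. D * C) t"
      unfolding h_def using B(2) bD contB
      by (intro duhamel_mono) (auto simp: C_def indicator_def intro: order_trans)
    moreover have "duhamel D 0 (\<lambda>_. D * 0) t \<le> h z t"
      unfolding h_def using B(1) contB by (intro duhamel_mono) auto
    ultimately show ?thesis
      using duhamel_const[OF that, of D C] duhamel_const[OF that, of D 0] by simp
  qed
  have eq: "heat w m t (indicator {x}) z = h z t" if "0 \<le> t" for z t
    by (rule heat_unique[OF sc solh hb _ that]) (simp_all add: h_def)
  have "(h z has_real_derivative B z t - D * heat w m t (indicator {x}) z) (at t within {0..})"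
    using h'[OF t] eq[OF t] by simp
  then have "((\<lambda>t. heat w m t (indicator {x}) z) has_real_derivative
      B z t - D * heat w m t (indicator {x}) z) (at t within {0..})"
    by (rule has_field_derivative_transform_within[where d = 1]) (use t eq in auto)
  then show ?thesis by (simp add: B_def D_def)
qed

text \<open>
  By the forward equation \<open>heat_kernel w m t x z\<close> solves the heat equation in \<open>x\<close>, but it is not
  evidently bounded in \<open>x\<close>; minimality gives one inequality, and exchanging the vertices the other.
\<close>

lemma heat_kernel_symmetric:
  assumes sc: "stochastically_complete w m" and t: "0 \<le> t"
  shows "heat_kernel w m t x z = heat w m t (indicator {z}) x"
proof -
  have le: "heat w m t (indicator {z}) x \<le> m z / m x * heat w m t (indicator {x}) z" for x z
  proof (rule heat_of_nonneg(2)[where v = "\<lambda>x t. m z / m x * heat w m t (indicator {x}) z", OF _ bounded_indicator])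
    show "solves_heat (\<lambda>x t. m z / m x * heat w m t (indicator {x}) z)"
      unfolding solves_heat_def
    proof (intro allI impI)
      fix x and t :: real assume t: "0 \<le> t"
      have "laplacian w m (\<lambda>y. m z / m y * heat w m t (indicator {y}) z) x = m z / m x *
          ((\<Sum>y | (x, y) \<in> edges w. w x y / m y * heat w m t (indicator {y}) z)
            - Deg w m x * heat w m t (indicator {x}) z)"
        unfolding laplacian_inflow inflow_def
        by (simp add: algebra_simps sum_distrib_left sum_divide_distrib)
      then show "((\<lambda>t. m z / m x * heat w m t (indicator {x}) z) has_real_derivative
          laplacian w m (\<lambda>y. m z / m y * heat w m t (indicator {y}) z) x) (at t within {0..})"
        using DERIV_cmult[OF heat_indicator_forward[OF sc t], of "m z / m x" x z] by simp
    qed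
    show "0 \<le> m z / m x * heat w m t (indicator {x}) z" if "0 \<le> t" for x t
      using that heat_of_nonneg(1)[OF _ bounded_indicator] measure_pos
      by (intro mult_nonneg_nonneg divide_nonneg_nonneg) (auto simp: less_imp_le)
    show "m z / m x * heat w m 0 (indicator {x}) z = indicator {z} x" for x
      using measure_pos[of z] unfolding heat_0[OF bounded_indicator] by (auto simp: indicator_def)
  qed (use t in auto)
  \<comment> \<open>The inequality just proved, with the vertices exchanged and multiplied by the
    inverse ratio of measures, is the reverse one.\<close>
  have "m z / m x * heat w m t (indicator {x}) z \<le>
      m z / m x * (m x / m z * heat w m t (indicator {z}) x)"
    using measure_pos by (intro mult_left_mono le) (auto simp: less_imp_le)
  also have "\<dots> = heat w m t (indicator {z}) x"
    using measure_pos[of x] measure_pos[of z] by simp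
  finally show ?thesis using le[of z x] by (simp add: heat_kernel_def)
qed

text \<open>Partial sums over a finite exhaustion are solutions bounded by \<open>C\<close>. Their
  limit is a bounded solution starting from \<open>f\<close>, and uniqueness identifies it.\<close>

lemma has_sum_heat_kernel:
  assumes sc: "stochastically_complete w m" and f: "bounded (range f)" and t: "0 \<le> t"
  shows "((\<lambda>z. f z * heat_kernel w m t x z) has_sum heat w m t f x) UNIV"
proof -
  obtain C where C: "\<bar>f x\<bar> \<le> C" for x
    using f unfolding bounded_range_iff by blast
  define p where "p z x t = heat w m t (indicator {z}) x" for z x t
  have p0: "0 \<le> p z x t" if "0 \<le> t" for z x t
    unfolding p_def by (intro heat_of_nonneg(1) bounded_indicator that) simp
  have solp: "solves_heat (p z)" for z
    unfolding p_def by (intro heat_solves bounded_indicator)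
  \<comment> \<open>Uniqueness identifies the sum with the evolution of \<open>indicator F\<close>,
    which stays below 1.\<close>
  have le1: "(\<Sum>z\<in>F. p z x t) \<le> 1" if F: "finite F" and t: "0 \<le> t" for F x t
  proof -
    have "heat w m t (indicator F) x = (\<Sum>z\<in>F. 1 * p z x t)"
    proof (rule heat_unique[OF sc _ _ _ t])
      show "solves_heat (\<lambda>x t. \<Sum>z\<in>F. 1 * p z x t)"
        by (intro solves_heat_sum solp)
      show "\<bar>\<Sum>z\<in>F. 1 * p z x t\<bar> \<le> (\<Sum>z\<in>F. 1)" if "0 \<le> t" for x t
      proof (rule order_trans[OF sum_abs sum_mono])
        fix z show "\<bar>1 * p z x t\<bar> \<le> 1"
          unfolding p_def using that abs_heat_le[of "indicator {z}" 1 t x]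
          by (auto simp: indicator_def)
      qed
      show "(\<Sum>z\<in>F. 1 * p z x 0) = indicator F x" for x
        unfolding p_def heat_0[OF bounded_indicator] using F by (simp add: indicator_def of_bool_def)
    qed
    then show ?thesis
      using abs_heat_le[of "indicator F" 1 t x] t by (auto simp: indicator_def)
  qed
  have summable_p: "(\<lambda>z. p z x t) summable_on UNIV" if "0 \<le> t" for x t
    using that by (intro nonneg_bdd_above_summable_on bdd_aboveI2[where M = 1] p0) (auto intro: le1)
  have summable: "(\<lambda>z. f z * p z x t) summable_on UNIV" if "0 \<le> t" for x t
  proof (rule abs_summable_summable, rule summable_on_comparison_test)
    show "(\<lambda>z. C * p z x t) summable_on UNIV"
      by (intro summable_on_cmult_right summable_p that)
    show "norm (f z * p z x t) \<le> C * p z x t" for z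
      using C[of z] p0[OF that, of z x] by (simp add: abs_mult mult_right_mono)
  qed auto
  \<comment> \<open>Exhaustion along the enumeration of the vertices: it turns the unordered sum
    into a limit of a sequence, as \<open>solves_heat_limit\<close> and dominated convergence
    require.\<close>
  define F where "F n = {z :: 'v. to_nat z < n}" for n
  have finF: "finite (F n)" for n
    using finite_vimageI[of "{..<n}" "to_nat :: 'v \<Rightarrow> nat"] by (simp add: F_def vimage_def)
  have limF: "filterlim F (finite_subsets_at_top UNIV) sequentially"
    unfolding filterlim_finite_subsets_at_top
  proof (intro allI impI)
    fix X :: "'v set" assume "finite X \<and> X \<subseteq> UNIV"
    then have "X \<subseteq> F n" if "Max (insert 0 (to_nat ` X)) < n" for n
      using that by (auto simp: F_def)
    then show "\<forall>\<^sub>F n in sequentially. finite (F n) \<and> X \<subseteq> F n \<and> F n \<subseteq> UNIV"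
      using finF
      by (intro eventually_mono[OF eventually_gt_at_top[of "Max (insert 0 (to_nat ` X))"]]) simp
  qed
  define u where "u n x t = (\<Sum>z\<in>F n. f z * p z x t)" for n x t
  define U where "U x t = (\<Sum>\<^sub>\<infinity>z. f z * p z x t)" for x t
  have solu: "solves_heat (u n)" for n
    unfolding u_def[abs_def] by (intro solves_heat_sum solp)
  have lim: "(\<lambda>n. u n x t) \<longlonglongrightarrow> U x t" if "0 \<le> t" for x t
    unfolding u_def U_def by (rule filterlim_compose[OF infsum_tendsto[OF summable[OF that]] limF])
  have bound: "\<bar>u n x t\<bar> \<le> C" if t: "0 \<le> t" for n x t
  proof -
    have "\<bar>u n x t\<bar> \<le> (\<Sum>z\<in>F n. C * p z x t)"
      unfolding u_def using C p0[OF t]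
      by (intro order_trans[OF sum_abs sum_mono]) (simp add: abs_mult mult_right_mono)
    also have "\<dots> \<le> C * 1"
      unfolding sum_distrib_left[symmetric] using C[of undefined]
      by (intro mult_left_mono le1 finF t) auto
    finally show ?thesis by simp
  qed
  have init: "(\<lambda>n. u n x 0) \<longlonglongrightarrow> f x" for x
  proof (rule tendsto_eventually)
    have "u n x 0 = f x" if "to_nat x < n" for n
    proof -
      have "u n x 0 = (\<Sum>z\<in>F n. if x = z then f z else 0)"
        unfolding u_def p_def by (intro sum.cong) (auto simp: heat_0 bounded_indicator)
      also have "\<dots> = f x" using that finF by (simp add: F_def)
      finally show ?thesis .
    qed
    then show "\<forall>\<^sub>F n in sequentially. u n x 0 = f x"
      by (intro eventually_mono[OF eventually_gt_at_top[of "to_nat x"]]) simp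
  qed
  note sol = solves_heat_limit[of u C U u "\<lambda>n x. u n x 0" f,
      OF solves_heat_continuous[OF solu] bound lim solves_heat_eq_duhamel[OF solu] lim init]
  have "heat w m t f x = U x t"
  proof (rule heat_unique[OF sc sol(1) _ sol(2) t])
    show "\<bar>U x t\<bar> \<le> C" if "0 \<le> t" for x t
      using tendsto_upperbound[OF tendsto_rabs[OF lim[OF that]]] bound[OF that] by simp
  qed
  moreover have "heat_kernel w m t x z = p z x t" for z
    unfolding p_def by (rule heat_kernel_symmetric[OF sc t])
  ultimately show ?thesis using has_sum_infsum[OF summable[OF t]] by (simp add: U_def)
qed

subsection \<open>Curvature and the Laplacian\<close>

text \<open>Integration against the jump measure is one explicit Euler step of the heat flow. The
  identity is algebraic and holds for every \<epsilon>.\<close>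

lemma has_sum_jump_measure:
  "((\<lambda>z. f z * jump_measure w m \<epsilon> x z) has_sum f x + \<epsilon> * laplacian w m f x) UNIV"
proof -
  let ?N = "{z. (x, z) \<in> edges w}"
  have x: "x \<notin> ?N" by (simp add: edge_iff weight_diag)
  have "(\<Sum>z\<in>?N. f z * jump_measure w m \<epsilon> x z) = \<epsilon> * inflow f x"
    unfolding inflow_def sum_divide_distrib sum_distrib_left
    using x by (intro sum.cong) (auto simp: jump_measure_def)
  then have "(\<Sum>z\<in>insert x ?N. f z * jump_measure w m \<epsilon> x z) = f x + \<epsilon> * laplacian w m f x"
    using x locally_finite[of x]
    by (simp add: jump_measure_def[of _ _ _ x x] laplacian_inflow algebra_simps)
  moreover have "((\<lambda>z. f z * jump_measure w m \<epsilon> x z) has_sum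
      (\<Sum>z\<in>insert x ?N. f z * jump_measure w m \<epsilon> x z)) (insert x ?N)"
    by (intro has_sum_finite) (simp add: locally_finite)
  moreover have "w x z = 0" if "z \<notin> ?N" for z
    using that weight_nonneg[of x z] by (simp add: edge_iff)
  ultimately show ?thesis
    by (subst has_sum_cong_neutral[where T = "insert x ?N"]) (auto simp: jump_measure_def)
qed

text \<open>The value of the potential \<open>f\<close> in the dual transport problem between the
  two jump measures.\<close>

definition transport :: "'v \<Rightarrow> 'v \<Rightarrow> real \<Rightarrow> ('v \<Rightarrow> real) \<Rightarrow> real" where
  "transport x y \<epsilon> f = f x - f y + \<epsilon> * (laplacian w m f x - laplacian w m f y)"

lemma infsum_jump_measure_diff:
  "(\<Sum>\<^sub>\<infinity>z. f z * (jump_measure w m \<epsilon> x z - jump_measure w m \<epsilon> y z)) = transport x y \<epsilon> f"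
proof (rule infsumI)
  have "((\<lambda>z. f z * jump_measure w m \<epsilon> x z + (- 1) * (f z * jump_measure w m \<epsilon> y z)) has_sum
      (f x + \<epsilon> * laplacian w m f x) + (- 1) * (f y + \<epsilon> * laplacian w m f y)) UNIV"
    by (intro has_sum_add has_sum_cmult_right has_sum_jump_measure)
  then show "((\<lambda>z. f z * (jump_measure w m \<epsilon> x z - jump_measure w m \<epsilon> y z)) has_sum
      transport x y \<epsilon> f) UNIV"
    by (simp add: transport_def algebra_simps)
qed

abbreviation bounded_Lip1 :: "('v \<Rightarrow> real) set" where
  "bounded_Lip1 \<equiv> {f \<in> Lip1 w. bounded (range f)}"

definition transport_cost :: "'v \<Rightarrow> 'v \<Rightarrow> real \<Rightarrow> real" where
  "transport_cost x y \<epsilon> = (SUP f\<in>bounded_Lip1. transport x y \<epsilon> f)"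

lemma bounded_Lip1_nonempty: "bounded_Lip1 \<noteq> {}"
  using Lip1_const[of 0] by auto

lemma transport_le:
  assumes "f \<in> Lip1 w" "0 \<le> \<epsilon>"
  shows "transport x y \<epsilon> f \<le> gdist w x y + \<epsilon> * (Deg w m x + Deg w m y)"
  unfolding transport_def
  using Lip1D[OF assms(1), of x y] abs_laplacian_Lip1[OF assms(1), of x]
    abs_laplacian_Lip1[OF assms(1), of y] assms(2)
  by (intro add_mono mult_left_mono) auto

lemma bdd_above_transport: "0 \<le> \<epsilon> \<Longrightarrow> bdd_above (transport x y \<epsilon> ` bounded_Lip1)"
  by (rule bdd_aboveI2[OF transport_le]) auto

lemma transport_le_cost:
  "f \<in> bounded_Lip1 \<Longrightarrow> 0 \<le> \<epsilon> \<Longrightarrow> transport x y \<epsilon> f \<le> transport_cost x y \<epsilon>"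
  unfolding transport_cost_def by (rule cSUP_upper[OF _ bdd_above_transport])

lemma transport_cost_le:
  "(\<And>f. f \<in> bounded_Lip1 \<Longrightarrow> transport x y \<epsilon> f \<le> c) \<Longrightarrow> transport_cost x y \<epsilon> \<le> c"
  unfolding transport_cost_def by (rule cSUP_least[OF bounded_Lip1_nonempty])

lemma wasserstein_jump_measure:
  assumes "0 \<le> \<epsilon>"
  shows "wasserstein w (jump_measure w m \<epsilon> x) (jump_measure w m \<epsilon> y) = ereal (transport_cost x y \<epsilon>)"
proof -
  have "(SUP f\<in>bounded_Lip1. ereal (transport x y \<epsilon> f))
      \<le> ereal (gdist w x y + \<epsilon> * (Deg w m x + Deg w m y))"
    using transport_le[OF _ assms] by (intro SUP_least) auto
  moreover have "ereal (transport x y \<epsilon> (\<lambda>_. 0)) \<le> (SUP f\<in>bounded_Lip1. ereal (transport x y \<epsilon> f))"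
    using Lip1_const[of 0] by (intro SUP_upper) auto
  ultimately have "\<bar>SUP f\<in>bounded_Lip1. ereal (transport x y \<epsilon> f)\<bar> \<noteq> \<infinity>"
    by (cases "SUP f\<in>bounded_Lip1. ereal (transport x y \<epsilon> f)") auto
  then show ?thesis
    by (simp add: wasserstein_def infsum_jump_measure_diff transport_cost_def ereal_SUP)
qed

lemma curvature_eps_eq:
  assumes "x \<noteq> y" "0 < \<epsilon>"
  shows "ereal (1 / \<epsilon>) * curvature_eps w m \<epsilon> x y =
    ereal ((1 / \<epsilon>) * (1 - transport_cost x y \<epsilon> / gdist w x y))"
  using assms gdist_pos[OF assms(1)]
  by (simp add: curvature_eps_def wasserstein_jump_measure one_ereal_def del: ereal_eq_1)

text \<open>
  The cost is a supremum of functions affine in \<open>\<epsilon>\<close>, hence convex, and is at most the distance at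
  \<open>\<epsilon> = 0\<close>.
\<close>

lemma curvature_quotient_antimono:
  assumes xy: "x \<noteq> y" and ab: "0 < a" "a \<le> b"
  shows "(1 / b) * (1 - transport_cost x y b / gdist w x y)
    \<le> (1 / a) * (1 - transport_cost x y a / gdist w x y)"
proof -
  let ?d = "real (gdist w x y)"
  have d: "0 < ?d" using gdist_pos[OF xy] by simp
  then have d': "?d \<noteq> 0" by linarith
  have "transport_cost x y a \<le> (1 - a / b) * ?d + a / b * transport_cost x y b"
  proof (rule transport_cost_le)
    fix f assume f: "f \<in> bounded_Lip1"
    have "transport x y a f = (1 - a / b) * (f x - f y) + a / b * transport x y b f"
      using ab by (simp add: transport_def field_simps)
    also have "\<dots> \<le> (1 - a / b) * ?d + a / b * transport_cost x y b"
      using f ab Lip1D[of f x y]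
      by (intro add_mono mult_left_mono transport_le_cost) auto
    finally show "transport x y a f \<le> \<dots>" .
  qed
  then have "a * (?d - transport_cost x y b) \<le> b * (?d - transport_cost x y a)"
    using ab by (simp add: field_simps)
  then have "(?d - transport_cost x y b) / b \<le> (?d - transport_cost x y a) / a"
    using ab by (simp add: pos_divide_le_eq pos_le_divide_eq mult.commute)
  then have "(?d - transport_cost x y b) / b / ?d \<le> (?d - transport_cost x y a) / a / ?d"
    using d by (intro divide_right_mono) auto
  then show ?thesis by (simp only: quotient_eq[OF d'])
qed

text \<open>\<open>Lim\<close> is a definite description; monotonicity of the quotient supplies the
  existence that turns it into actual convergence.\<close>

lemma curvature_tendsto:
  assumes xy: "x \<noteq> y"
  shows "((\<lambda>\<epsilon>. ereal ((1 / \<epsilon>) * (1 - transport_cost x y \<epsilon> / gdist w x y))) \<longlongrightarrow>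
    curvature w m x y) (at_right 0)"
proof -
  let ?g = "\<lambda>\<epsilon>. ereal ((1 / \<epsilon>) * (1 - transport_cost x y \<epsilon> / gdist w x y))"
  have lim: "(?g \<longlongrightarrow> (SUP \<epsilon>\<in>{0<..}. ?g \<epsilon>)) (at_right 0)"
    using curvature_quotient_antimono[OF xy]
    by (intro tendsto_at_right_SUP) simp
  then have "((\<lambda>\<epsilon>. ereal (1 / \<epsilon>) * curvature_eps w m \<epsilon> x y) \<longlongrightarrow> (SUP \<epsilon>\<in>{0<..}. ?g \<epsilon>)) (at_right 0)"
    by (rule Lim_transform_eventually)
      (use curvature_eps_eq[OF xy] in \<open>auto simp: eventually_at_right_less
        intro: eventually_mono[OF eventually_at_right_less]\<close>)
  then have "curvature w m x y = (SUP \<epsilon>\<in>{0<..}. ?g \<epsilon>)"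
    unfolding curvature_def by (rule tendsto_Lim[OF trivial_limit_at_right_real])
  with lim show ?thesis by simp
qed

text \<open>The single potential - h, suitably truncated, bounds the cost from below for every
  \<epsilon>, and its quotient does not depend on \<epsilon>.\<close>

lemma curvature_le:
  assumes xy: "x \<noteq> y" and h: "h \<in> Lip1 w" "h y - h x = gdist w x y"
  shows "curvature w m x y \<le> ereal ((laplacian w m h x - laplacian w m h y) / gdist w x y)"
proof -
  let ?d = "real (gdist w x y)"
  have d: "0 < ?d" using gdist_pos[OF xy] by simp
  then have d': "?d \<noteq> 0" by linarith
  \<comment> \<open>All vertices that the two Laplacians see. Truncating at height \<open>M\<close>
    changes nothing there and gives the boundedness that potentials need.\<close>
  define S where "S = {x, y} \<union> {z. (x, z) \<in> edges w} \<union> {z. (y, z) \<in> edges w}"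
  have finS: "finite S" by (simp add: S_def locally_finite)
  define M where "M = Max ((\<lambda>z. \<bar>h z\<bar>) ` S)"
  have M: "\<bar>h z\<bar> \<le> M" if "z \<in> S" for z
    unfolding M_def using finS that by (intro Max_ge) auto
  define f where "f z = - max (min (h z) M) (- M)" for z
  have fS: "f z = - h z" if "z \<in> S" for z
    using M[OF that] by (auto simp: f_def)
  have "0 \<le> M" using M[of x] by (auto simp: S_def)
  then have "\<bar>f z\<bar> \<le> M" for z by (auto simp: f_def)
  then have f: "f \<in> bounded_Lip1"
    unfolding f_def
    by (auto simp: bounded_range_iff intro!: Lip1_uminus Lip1_max Lip1_min h Lip1_const)
  have "laplacian w m f z = - laplacian w m h z" if "z \<in> {x, y}" for z
    using fS that laplacian_cong[of z f "\<lambda>z. - h z"] by (auto simp: laplacian_uminus S_def)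
  then have T: "transport x y \<epsilon> f = ?d - \<epsilon> * (laplacian w m h x - laplacian w m h y)" for \<epsilon>
    using h(2) fS by (simp add: transport_def S_def algebra_simps)
  have "(1 / \<epsilon>) * (1 - transport_cost x y \<epsilon> / ?d) \<le> (laplacian w m h x - laplacian w m h y) / ?d"
    if "0 < \<epsilon>" for \<epsilon>
  proof -
    have "?d - transport_cost x y \<epsilon> \<le> \<epsilon> * (laplacian w m h x - laplacian w m h y)"
      using transport_le_cost[OF f, of \<epsilon> x y] that unfolding T by simp
    then have "(?d - transport_cost x y \<epsilon>) / \<epsilon> / ?d \<le> (laplacian w m h x - laplacian w m h y) / ?d"
      using d that by (intro divide_right_mono) (auto simp: pos_divide_le_eq mult.commute)
    then show ?thesis by (simp only: quotient_eq[OF d'])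
  qed
  then show ?thesis
    by (intro tendsto_upperbound[OF curvature_tendsto[OF xy]] eventually_mono[OF eventually_at_right_less])
      auto
qed

text \<open>The quotient is at least (1 - exp(- K \<epsilon>)) / \<epsilon> - C \<epsilon> / d,
  which tends to \<open>K\<close>; second-order errors disappear.\<close>

lemma curvature_ge:
  assumes xy: "x \<noteq> y"
    and T: "\<And>\<epsilon> f. 0 < \<epsilon> \<Longrightarrow> f \<in> bounded_Lip1 \<Longrightarrow>
      transport x y \<epsilon> f \<le> exp (- K * \<epsilon>) * gdist w x y + C * \<epsilon>\<^sup>2"
  shows "ereal K \<le> curvature w m x y"
proof (rule tendsto_le[OF trivial_limit_at_right_real curvature_tendsto[OF xy]])
  let ?d = "real (gdist w x y)"
  have d: "0 < ?d" using gdist_pos[OF xy] by simp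
  then have d': "?d \<noteq> 0" by linarith
  let ?l = "\<lambda>\<epsilon>. - ((exp (- K * \<epsilon>) - 1) / \<epsilon>) - C / ?d * \<epsilon>"
  have "((\<lambda>\<epsilon>. exp (- K * \<epsilon>)) has_real_derivative - K) (at 0)"
    by (auto intro!: derivative_eq_intros)
  then have "((\<lambda>\<epsilon>. (exp (- K * \<epsilon>) - 1) / \<epsilon>) \<longlongrightarrow> - K) (at_right 0)"
    by (auto simp: has_field_derivative_iff intro: filterlim_mono at_le)
  then have "(?l \<longlongrightarrow> - (- K) - C / ?d * 0) (at_right 0)"
    by (intro tendsto_intros)
  then show "((\<lambda>\<epsilon>. ereal (?l \<epsilon>)) \<longlongrightarrow> ereal K) (at_right 0)" by simp
  have "?l \<epsilon> \<le> (1 / \<epsilon>) * (1 - transport_cost x y \<epsilon> / ?d)" if "0 < \<epsilon>" for \<epsilon>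
  proof -
    have "transport_cost x y \<epsilon> \<le> exp (- K * \<epsilon>) * ?d + C * \<epsilon>\<^sup>2"
      using T that by (intro transport_cost_le)
    then have "(1 / \<epsilon>) * (1 - (exp (- K * \<epsilon>) * ?d + C * \<epsilon>\<^sup>2) / ?d)
        \<le> (1 / \<epsilon>) * (1 - transport_cost x y \<epsilon> / ?d)"
      using that d by (intro mult_left_mono diff_left_mono divide_right_mono) auto
    moreover have "?l \<epsilon> = (1 / \<epsilon>) * (1 - (exp (- K * \<epsilon>) * ?d + C * \<epsilon>\<^sup>2) / ?d)"
      using that by (intro quotient_linear_eq d') simp
    ultimately show ?thesis by simp
  qed
  then show "\<forall>\<^sub>F \<epsilon> in at_right 0. ereal (?l \<epsilon>) \<le> ereal ((1 / \<epsilon>) * (1 - transport_cost x y \<epsilon> / ?d))"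
    by (intro eventually_mono[OF eventually_at_right_less]) auto
qed

text \<open>\<open>curvature_le\<close> applied to h / c. The free slope \<open>c\<close> is there
  because the Lipschitz constant along the flow changes with time.\<close>

lemma Ric_ge_laplacian:
  fixes h :: "'v \<Rightarrow> real" and c K :: real
  assumes ric: "Ric_ge w m K" and c: "0 < c"
    and h: "\<And>z z'. \<bar>h z - h z'\<bar> \<le> c * gdist w z z'" "h y - h x = c * gdist w x y"
  shows "laplacian w m h y - laplacian w m h x \<le> - K * (c * gdist w x y)"
proof (cases "x = y")
  case False
  let ?d = "real (gdist w x y)"
  have d: "0 < ?d" using gdist_pos[OF False] by simp
  let ?h = "\<lambda>z. (1 / c) * h z"
  have "\<bar>?h z - ?h z'\<bar> \<le> gdist w z z'" for z z'
  proof -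
    have "?h z - ?h z' = (h z - h z') / c"
      by (simp add: diff_divide_distrib)
    then show ?thesis
      using h(1)[of z z'] c by (simp add: abs_divide pos_divide_le_eq mult.commute)
  qed
  then have "?h \<in> Lip1 w" by (simp add: Lip1_def)
  moreover have "?h y - ?h x = ?d"
  proof -
    have "?h y - ?h x = (h y - h x) / c" by (simp add: diff_divide_distrib)
    then show ?thesis using h(2) c by simp
  qed
  ultimately have "curvature w m x y \<le> ereal ((laplacian w m ?h x - laplacian w m ?h y) / ?d)"
    by (rule curvature_le[OF False])
  moreover have "ereal K \<le> curvature w m x y"
    using ric False by (simp add: Ric_ge_def)
  ultimately have "ereal K \<le> ereal ((laplacian w m ?h x - laplacian w m ?h y) / ?d)"
    by (rule order_trans[rotated])
  then have "K * ?d \<le> laplacian w m ?h x - laplacian w m ?h y"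
    using d by (simp add: pos_le_divide_eq)
  then have "K * ?d \<le> (laplacian w m h x - laplacian w m h y) / c"
    unfolding laplacian_cmult by (simp add: diff_divide_distrib)
  then have "K * ?d * c \<le> laplacian w m h x - laplacian w m h y"
    using c by (simp add: pos_le_divide_eq)
  then show ?thesis by (simp add: algebra_simps)
qed simp

text \<open>The function d(v, .) attains slope 1 between \<open>v\<close> and every
  \<open>x\<close>, so its Laplacian at \<open>x\<close> is controlled by the one at
  \<open>v\<close>, which is at most the degree. The absolute value covers both signs of
  \<open>K\<close>.\<close>

lemma Ric_ge_laplacian_gdist:
  assumes "Ric_ge w m K"
  shows "laplacian w m (\<lambda>z. real (gdist w v z)) x \<le> Deg w m v + \<bar>K\<bar> * gdist w v x"
proof -
  let ?\<rho> = "\<lambda>z. real (gdist w v z)"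
  have "laplacian w m ?\<rho> x - laplacian w m ?\<rho> v \<le> - K * (1 * real (gdist w v x))"
    using Lip1_gdist[of v] by (intro Ric_ge_laplacian[OF assms]) (auto simp: Lip1_def)
  moreover have "- K * (1 * real (gdist w v x)) \<le> \<bar>K\<bar> * gdist w v x"
    by (intro order_trans[OF mult_right_mono[of "- K" "\<bar>K\<bar>"]]) auto
  ultimately show ?thesis
    using abs_laplacian_Lip1[OF Lip1_gdist, of v v] by linarith
qed

subsection \<open>The gradient estimate\<close>

text \<open>
  The infimal convolution of \<open>b\<close> with the distance is a Lipschitz function between \<open>a\<close> and
  \<open>b + M\<close>, touching \<open>a\<close> at \<open>y\<close> and \<open>b + M\<close> at \<open>x\<close>. This replaces an optimal coupling of the
  neighbours of \<open>x\<close> and \<open>y\<close>.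
\<close>

lemma Ric_ge_laplacian_doubling:
  fixes a b :: "'v \<Rightarrow> real" and c K :: real
  assumes ric: "Ric_ge w m K" and c: "0 < c"
    and bdd: "\<And>x'. B \<le> b x'"
    and le: "\<And>x' y'. a y' \<le> b x' + c * gdist w x' y' + M"
    and eq: "a y = b x + c * gdist w x y + M"
  shows "laplacian w m a y - laplacian w m b x \<le> - K * (c * gdist w x y)"
proof -
  let ?g = "\<lambda>z x'. b x' + c * gdist w x' z"
  define h where "h z = (INF x'. ?g z x') + M" for z
  have bdd: "bdd_below (range (?g z))" for z
    using bdd c by (intro bdd_belowI2[where m = B]) (simp add: add_increasing2)
  have h_le: "h z \<le> b x' + c * gdist w x' z + M" for z x'
    unfolding h_def using cINF_lower[OF bdd, of x' z] by simp
  have le_h: "v \<le> h z" if "\<And>x'. v \<le> b x' + c * gdist w x' z + M" for v z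
  proof -
    have "v - M \<le> (INF x'. ?g z x')"
      using that by (intro cINF_greatest) (auto simp: algebra_simps)
    then show ?thesis by (simp add: h_def)
  qed
  have lip: "h z - c * gdist w z z' \<le> h z'" for z z'
  proof (rule le_h)
    fix x'
    have "gdist w x' z \<le> gdist w x' z' + gdist w z z'"
      using gdist_triangle[of x' z z'] gdist_sym[of z z'] by simp
    then have "c * gdist w x' z \<le> c * (gdist w x' z' + gdist w z z')"
      using c by (intro mult_left_mono) auto
    then show "h z - c * gdist w z z' \<le> b x' + c * gdist w x' z' + M"
      using h_le[of z x'] by (simp add: algebra_simps)
  qed
  have ah: "a z \<le> h z" for z by (intro le_h le)
  have hb: "h z \<le> b z + M" for z using h_le[of z z] by simp
  have hy: "h y = a y" using h_le[of y x] ah[of y] eq by simp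
  have hx: "h x = b x + M" using lip[of y x] hb[of x] eq hy gdist_sym[of x y] by simp
  have "laplacian w m h y - laplacian w m h x \<le> - K * (c * gdist w x y)"
  proof (rule Ric_ge_laplacian[OF ric c])
    show "\<bar>h z - h z'\<bar> \<le> c * gdist w z z'" for z z'
      using lip[of z z'] lip[of z' z] gdist_sym[of z z'] by simp
    show "h y - h x = c * gdist w x y" using hx hy eq by simp
  qed
  moreover have "laplacian w m a y \<le> laplacian w m h y"
    using ah hy by (intro laplacian_mono_touching) auto
  moreover have "laplacian w m h x \<le> laplacian w m (\<lambda>z. b z + M) x"
    using hb hx by (intro laplacian_mono_touching) auto
  ultimately show ?thesis by (simp add: laplacian_add)
qed

text \<open>A violation of the penalised bound yields a positive maximum at a time s > 0 at which
  the time derivative is strictly negative. Then the penalty is sent to 0.\<close>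

lemma Ric_ge_solution_Lipschitz:
  fixes L :: real
  assumes ric: "Ric_ge w m K" and u: "solves_heat u"
    and B: "\<And>x t. 0 \<le> t \<Longrightarrow> \<bar>u x t\<bar> \<le> B"
    and L: "0 < L" "\<And>x y. \<bar>u x 0 - u y 0\<bar> \<le> L * gdist w x y"
    and T: "0 \<le> T"
  shows "u y T - u x T \<le> exp (- K * T) * L * gdist w x y"
proof -
  define v :: 'v where "v = undefined"
  define \<rho> where "\<rho> z = real (gdist w v z)" for z
  define A where "A = Deg w m v"
  \<comment> \<open>Chosen so that growth of the penalty beats the two distance Laplacians: 2 A
    absorbs their constants, \<bar>K\<bar> their linear growth, and the final 1 gives
    strictness.\<close>
  define C where "C = 2 * A + \<bar>K\<bar> + 1"
  have A: "0 \<le> A" unfolding A_def by (rule Deg_nonneg)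
  have \<rho>0: "0 \<le> \<rho> z" for z by (simp add: \<rho>_def)
  have lap\<rho>: "laplacian w m \<rho> z \<le> A + \<bar>K\<bar> * \<rho> z" for z
    unfolding \<rho>_def[abs_def] A_def by (rule Ric_ge_laplacian_gdist[OF ric])
  have "u y T - u x T \<le> exp (- K * T) * L * gdist w x y + \<eta> * ((\<rho> x + \<rho> y + 1) * exp (C * T))"
    if \<eta>: "0 < \<eta>" for \<eta>
  proof (rule ccontr)
    define F where "F p t = u (snd p) t - u (fst p) t
        - exp (- K * t) * L * gdist w (fst p) (snd p)
        - \<eta> * ((\<rho> (fst p) + \<rho> (snd p) + 1) * exp (C * t))" for p t
    assume "\<not> ?thesis"
    then have pos: "0 < F (x, y) T" by (simp add: F_def)
    \<comment> \<open>Where \<open>F\<close> is positive the penalty is below the oscillation 2 B of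
      \<open>u\<close>, which confines both vertices to a finite ball.\<close>
    define N where "N = nat \<lceil>2 * B / \<eta>\<rceil>"
    define P where "P = {z. gdist w v z \<le> N} \<times> {z. gdist w v z \<le> N}"
    have finP: "finite P" by (simp add: P_def finite_gball)
    have outside: "p \<in> P" if "0 < F p t" "0 \<le> t" for p t
    proof -
      obtain p1 p2 where p: "p = (p1, p2)" by fastforce
      have "1 \<le> exp (C * t)" using A that by (simp add: C_def)
      then have "(\<rho> p1 + \<rho> p2 + 1) * 1 \<le> (\<rho> p1 + \<rho> p2 + 1) * exp (C * t)"
        using \<rho>0[of p1] \<rho>0[of p2] by (intro mult_left_mono) auto
      then have "\<eta> * (\<rho> p1 + \<rho> p2 + 1) \<le> \<eta> * ((\<rho> p1 + \<rho> p2 + 1) * exp (C * t))"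
        using \<eta> by simp
      moreover have "0 \<le> exp (- K * t) * L * gdist w p1 p2" using L by simp
      ultimately have "\<eta> * (\<rho> p1 + \<rho> p2 + 1) \<le> 2 * B"
        using that(1) B[OF that(2), of p1] B[OF that(2), of p2]
        unfolding F_def p fst_conv snd_conv by linarith
      then have "\<rho> p1 + \<rho> p2 + 1 \<le> 2 * B / \<eta>"
        using \<eta> by (simp add: field_simps)
      then have "\<rho> p1 \<le> N" "\<rho> p2 \<le> N"
        using \<rho>0[of p1] \<rho>0[of p2] unfolding N_def by linarith+
      then show ?thesis by (simp add: P_def p \<rho>_def)
    qed
    have "\<exists>t\<in>{0..T}. \<forall>r\<in>{0..T}. F p r \<le> F p t" for p
      unfolding F_def using T
      by (intro continuous_attains_sup continuous_intros
          continuous_on_subset[OF solves_heat_continuous[OF u]]) auto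
    then obtain \<tau> where \<tau>: "\<tau> p \<in> {0..T}" "\<And>r. r \<in> {0..T} \<Longrightarrow> F p r \<le> F p (\<tau> p)" for p
      by metis
    have "P \<noteq> {}" using outside[OF pos T] by auto
    with finP have "Max ((\<lambda>q. F q (\<tau> q)) ` P) \<in> (\<lambda>q. F q (\<tau> q)) ` P"
      by (intro Max_in) auto
    then obtain p where "p \<in> P" and pmax: "Max ((\<lambda>q. F q (\<tau> q)) ` P) = F p (\<tau> p)"
      by blast
    have p: "F q (\<tau> q) \<le> F p (\<tau> p)" if "q \<in> P" for q
      using finP that unfolding pmax[symmetric] by (intro Max_ge) auto
    define s where "s = \<tau> p"
    have s: "0 \<le> s" "s \<le> T" using \<tau>(1)[of p] by (auto simp: s_def)
    have Fpos: "0 < F p s"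
      using pos \<tau>(2)[of T "(x, y)"] p[OF outside[OF pos T]] T by (simp add: s_def)
    have max: "F q r \<le> F p s" if "r \<in> {0..T}" for q r
    proof (cases "0 < F q r")
      case True
      then have "q \<in> P" using outside[of q r] that by simp
      then show ?thesis using \<tau>(2)[OF that, of q] p[of q] by (simp add: s_def)
    qed (use Fpos in simp)
    obtain x1 y1 where xy: "p = (x1, y1)" by fastforce
    let ?d = "real (gdist w x1 y1)"
    \<comment> \<open>At time 0 the Lipschitz bound on the initial data and the positive penalty
      make \<open>F\<close> negative.\<close>
    have "s \<noteq> 0"
    proof
      assume "s = 0"
      moreover have "0 < \<eta> * (\<rho> x1 + \<rho> y1 + 1)"
        using \<eta> \<rho>0[of x1] \<rho>0[of y1] by (intro mult_pos_pos) auto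
      ultimately show False using Fpos L(2)[of y1 x1] gdist_sym[of x1 y1] by (simp add: F_def xy)
    qed
    with s have s0: "0 < s" by simp
    define E where "E = exp (C * s)"
    define c where "c = exp (- K * s) * L"
    have \<eta>E: "0 < \<eta> * E" using \<eta> by (simp add: E_def)
    let ?D = "laplacian w m (\<lambda>z. u z s) y1 - laplacian w m (\<lambda>z. u z s) x1 + K * (c * ?d)
        - C * (\<eta> * E * (\<rho> x1 + \<rho> y1 + 1))"
    have u': "(u z has_real_derivative laplacian w m (\<lambda>z. u z s) z) (at s within {0..})" for z
      using u s by (simp add: solves_heat_def)
    have exp': "((\<lambda>t. exp (k * t)) has_real_derivative exp (k * s) * k) (at s within {0..})" for k
      by (auto intro!: derivative_eq_intros)
    have DF: "(F p has_real_derivative ?D) (at s within {0..})"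
      unfolding F_def[abs_def] xy fst_conv snd_conv
      by (rule DERIV_cong[OF DERIV_diff[OF DERIV_diff[OF DERIV_diff[OF u' u']
              DERIV_cmult_right[OF DERIV_cmult_right[OF exp']]] DERIV_cmult[OF DERIV_cmult[OF exp']]]])
        (simp add: c_def E_def)
    have "laplacian w m (\<lambda>z. u z s - \<eta> * E * \<rho> z) y1 - laplacian w m (\<lambda>z. u z s + \<eta> * E * \<rho> z) x1
        \<le> - K * (c * ?d)"
    \<comment> \<open>Maximality at time \<open>s\<close>, rearranged: each distance penalty joins
      the function of its own vertex, and the remaining constant \<eta> E goes into
      \<open>M\<close>.\<close>
    proof (rule Ric_ge_laplacian_doubling[OF ric, where M = "F p s + \<eta> * E" and B = "- B"])
      show "0 < c" using L by (simp add: c_def)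
      show "- B \<le> u z s + \<eta> * E * \<rho> z" for z
        using B[OF s(1), of z] mult_nonneg_nonneg[OF less_imp_le[OF \<eta>E] \<rho>0[of z]] by linarith
      show "u y' s - \<eta> * E * \<rho> y' \<le> u x' s + \<eta> * E * \<rho> x' + c * gdist w x' y' + (F p s + \<eta> * E)"
        for x' y'
        using max[of s "(x', y')"] s by (simp add: F_def[of "(x', y')"] E_def c_def algebra_simps)
      show "u y1 s - \<eta> * E * \<rho> y1 = u x1 s + \<eta> * E * \<rho> x1 + c * ?d + (F p s + \<eta> * E)"
        by (simp add: F_def xy E_def c_def algebra_simps)
    qed
    then have "laplacian w m (\<lambda>z. u z s) y1 - laplacian w m (\<lambda>z. u z s) x1 + K * (c * ?d)
        \<le> \<eta> * E * (laplacian w m \<rho> x1 + laplacian w m \<rho> y1)"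
      by (simp add: laplacian_diff laplacian_add laplacian_cmult algebra_simps)
    also have "\<dots> \<le> \<eta> * E * ((A + \<bar>K\<bar> * \<rho> x1) + (A + \<bar>K\<bar> * \<rho> y1))"
      using \<eta>E by (intro mult_left_mono add_mono lap\<rho>) auto
    also have "\<dots> < \<eta> * E * (C * (\<rho> x1 + \<rho> y1 + 1))"
    proof (rule mult_strict_left_mono[OF _ \<eta>E])
      have "0 \<le> 2 * A * (\<rho> x1 + \<rho> y1)" using A \<rho>0[of x1] \<rho>0[of y1] by simp
      then show "(A + \<bar>K\<bar> * \<rho> x1) + (A + \<bar>K\<bar> * \<rho> y1) < C * (\<rho> x1 + \<rho> y1 + 1)"
        using \<rho>0[of x1] \<rho>0[of y1] by (simp add: C_def algebra_simps)
    qed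
    finally have "?D < 0" by (simp add: algebra_simps)
    \<comment> \<open>Just before \<open>s\<close> the value would be larger than the maximum.
      Looking to the left is possible since s > 0 and includes the case s = T.\<close>
    from has_real_derivative_neg_dec_left[OF DF this] obtain e where e: "0 < e"
      "\<And>h. \<lbrakk>0 < h; s - h \<in> {0..}; h < e\<rbrakk> \<Longrightarrow> F p s < F p (s - h)"
      by blast
    define h where "h = min (e / 2) s"
    have "F p s < F p (s - h)" using e s0 by (intro e(2)) (auto simp: h_def)
    moreover have "F p (s - h) \<le> F p s" using e s s0 by (intro max) (auto simp: h_def)
    ultimately show False by simp
  qed
  note approx = this
  define R where "R = (\<rho> x + \<rho> y + 1) * exp (C * T)"
  have R: "0 < R" using \<rho>0[of x] \<rho>0[of y] by (simp add: R_def)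
  show ?thesis
  proof (rule field_le_epsilon)
    fix e :: real assume "0 < e"
    then show "u y T - u x T \<le> exp (- K * T) * L * gdist w x y + e"
      using approx[of "e / R", folded R_def] R by simp
  qed
qed

text \<open>The mean value inequality is used twice: for u - f at \<open>x\<close> and its
  neighbours, then for u - t \<Delta>f at \<open>x\<close>, whose derivative is the Laplacian of u -
  f. The function enters the constant only through its bound \<open>R\<close>.\<close>

lemma heat_short_time:
  assumes f: "\<And>z. \<bar>f z\<bar> \<le> R" and t: "0 \<le> t"
  shows "\<bar>heat w m t f x - f x - t * laplacian w m f x\<bar>
    \<le> 4 * Deg w m x * (Deg w m x + (\<Sum>z | (x, z) \<in> edges w. Deg w m z)) * R * t\<^sup>2"
proof -
  let ?u = "\<lambda>z t. heat w m t f z"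
  have bf: "bounded (range f)" using f unfolding bounded_range_iff by blast
  have R: "0 \<le> R" using f[of x] by linarith
  have u': "(?u z has_real_derivative laplacian w m (\<lambda>y. ?u y s) z) (at s within {0..t})"
    if "s \<in> {0..t}" for z s
  proof (rule DERIV_subset)
    show "(?u z has_real_derivative laplacian w m (\<lambda>y. ?u y s) z) (at s within {0..})"
      using heat_solves[OF bf] that by (simp add: solves_heat_def)
  qed auto
  have ub: "\<bar>?u z s\<bar> \<le> R" if "s \<in> {0..t}" for z s
    using that by (intro abs_heat_le f) auto
  have first: "\<bar>?u z s - f z\<bar> \<le> 2 * Deg w m z * R * t" if s: "s \<in> {0..t}" for z s
  proof -
    have "norm (?u z s - ?u z 0) \<le> 2 * Deg w m z * R * norm (s - 0)"
    proof (rule field_differentiable_bound[OF _ u'])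
      show "norm (laplacian w m (\<lambda>y. ?u y r) z) \<le> 2 * Deg w m z * R" if "r \<in> {0..t}" for r
        unfolding real_norm_def using that by (intro abs_laplacian_le ub)
    qed (use s in auto)
    also have "\<dots> \<le> 2 * Deg w m z * R * t"
      using s R Deg_nonneg[of z] by (intro mult_left_mono) auto
    finally show ?thesis by (simp add: heat_0[OF bf])
  qed
  let ?S = "Deg w m x + (\<Sum>z | (x, z) \<in> edges w. Deg w m z)"
  have S: "Deg w m z \<le> ?S" if "z = x \<or> (x, z) \<in> edges w" for z
    using that
  proof
    assume "(x, z) \<in> edges w"
    then have "Deg w m z \<le> (\<Sum>z | (x, z) \<in> edges w. Deg w m z)"
      by (intro member_le_sum locally_finite) (auto intro: Deg_nonneg)
    then show ?thesis using Deg_nonneg[of x] by linarith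
  qed (simp add: sum_nonneg Deg_nonneg)
  have near: "\<bar>?u z s - f z\<bar> \<le> 2 * ?S * R * t" if "z = x \<or> (x, z) \<in> edges w" "s \<in> {0..t}" for z s
    using S[OF that(1)] R t
    by (intro order_trans[OF first[OF that(2)]] mult_right_mono) auto
  have "norm ((?u x t - t * laplacian w m f x) - (?u x 0 - 0 * laplacian w m f x))
      \<le> (2 * Deg w m x * (2 * ?S * R * t)) * norm (t - 0)"
  proof (rule field_differentiable_bound[of "{0..t}"])
    fix s assume s: "s \<in> {0..t}"
    show "((\<lambda>t. ?u x t - t * laplacian w m f x) has_real_derivative
        laplacian w m (\<lambda>z. ?u z s - f z) x) (at s within {0..t})"
      unfolding laplacian_diff
      by (rule DERIV_cong[OF DERIV_diff[OF u'[OF s] DERIV_cmult_right[OF DERIV_ident]]]) simp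
    show "norm (laplacian w m (\<lambda>z. ?u z s - f z) x) \<le> 2 * Deg w m x * (2 * ?S * R * t)"
      unfolding real_norm_def using s by (intro abs_laplacian_le near) auto
  qed (use t in auto)
  then show ?thesis
    using t by (simp add: heat_0[OF bf] power2_eq_square algebra_simps)
qed

text \<open>Clamp \<open>f\<close> between - \<phi> and \<phi>, where \<phi> is the positive part of
  2 n - d(x, .). On the ball of radius \<open>n\<close> this is inactive, since there \<bar>f\<bar>
  \<le> d \<le> 2 n - d.\<close>

lemma Lip1_cutoff:
  assumes f: "f \<in> Lip1 w" and fx: "f x = 0"
  obtains g where "g \<in> Lip1 w" "finitely_supported g" "\<And>z. \<bar>g z\<bar> \<le> 2 * real n"
    "\<And>z. gdist w x z \<le> n \<Longrightarrow> g z = f z"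
proof
  define \<phi> where "\<phi> z = max (2 * real n - gdist w x z) 0" for z
  define g where "g z = max (min (f z) (\<phi> z)) (- \<phi> z)" for z
  have "(\<lambda>z. 2 * real n - gdist w x z) \<in> Lip1 w"
    using Lip1_diff_const[OF Lip1_uminus[OF Lip1_gdist[of x]], of "- 2 * real n"]
    by (simp add: algebra_simps)
  then have "\<phi> \<in> Lip1 w"
    unfolding \<phi>_def[abs_def] by (intro Lip1_max Lip1_const)
  then show "g \<in> Lip1 w"
    unfolding g_def[abs_def] by (intro Lip1_max Lip1_min Lip1_uminus f)
  have \<phi>0: "0 \<le> \<phi> z" for z by (simp add: \<phi>_def)
  have le\<phi>: "\<bar>g z\<bar> \<le> \<phi> z" for z using \<phi>0[of z] by (auto simp: g_def)
  have "g z = 0" if "\<not> gdist w x z \<le> 2 * n" for z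
    using le\<phi>[of z] that by (simp add: \<phi>_def)
  then have "{z. g z \<noteq> 0} \<subseteq> {z. gdist w x z \<le> 2 * n}" by blast
  then show "finitely_supported g"
    unfolding finitely_supported_def by (rule finite_subset[OF _ finite_gball])
  show "\<bar>g z\<bar> \<le> 2 * real n" for z
    using le\<phi>[of z] by (simp add: \<phi>_def)
  show "g z = f z" if "gdist w x z \<le> n" for z
  proof -
    have "\<bar>f z\<bar> \<le> gdist w x z"
      using Lip1D[OF f, of z x] Lip1D[OF f, of x z] fx by (simp add: gdist_sym[of z x] abs_le_iff)
    also have "\<dots> \<le> \<phi> z" using that by (simp add: \<phi>_def)
    finally show ?thesis by (auto simp: g_def)
  qed
qed

section \<open>Gradient norms as Lipschitz constants\<close>

lemma grad_norm_le_iff: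
  assumes "0 \<le> L"
  shows "grad_norm w f \<le> ennreal L \<longleftrightarrow> (\<forall>x y. \<bar>f x - f y\<bar> \<le> L * gdist w x y)"
proof -
  have "grad_norm w f \<le> ennreal L \<longleftrightarrow> (\<forall>x y. x \<noteq> y \<longrightarrow> \<bar>grad w f x y\<bar> \<le> L)"
    unfolding grad_norm_def SUP_le_iff using assms by (auto simp: ennreal_le_iff)
  also have "\<dots> \<longleftrightarrow> (\<forall>x y. x \<noteq> y \<longrightarrow> \<bar>f x - f y\<bar> \<le> L * gdist w x y)"
    using gdist_pos by (simp add: grad_def abs_divide pos_divide_le_eq)
  also have "\<dots> \<longleftrightarrow> (\<forall>x y. \<bar>f x - f y\<bar> \<le> L * gdist w x y)"
  proof (intro iffI allI)
    fix x y assume "\<forall>x y. x \<noteq> y \<longrightarrow> \<bar>f x - f y\<bar> \<le> L * gdist w x y"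
    then show "\<bar>f x - f y\<bar> \<le> L * gdist w x y" by (cases "x = y") auto
  qed simp
  finally show ?thesis .
qed

text \<open>Quantifying over all real L > 0 removes \<open>ennreal\<close> and lets later arguments
  divide by \<open>L\<close> without treating constant functions separately.\<close>

lemma grad_norm_contraction_iff:
  assumes f: "bounded (range f)" and c: "0 \<le> c"
  shows "grad_norm w g \<le> ennreal c * grad_norm w f \<longleftrightarrow>
    (\<forall>L>0::real. (\<forall>x y. \<bar>f x - f y\<bar> \<le> L * gdist w x y) \<longrightarrow>
      (\<forall>x y. \<bar>g x - g y\<bar> \<le> c * L * gdist w x y))"
proof (intro iffI allI impI)
  fix L :: real and x y
  assume le: "grad_norm w g \<le> ennreal c * grad_norm w f"
    and L: "0 < L" "\<forall>x y. \<bar>f x - f y\<bar> \<le> L * gdist w x y"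
  have "grad_norm w f \<le> ennreal L"
    using L by (simp add: grad_norm_le_iff)
  then have "ennreal c * grad_norm w f \<le> ennreal (c * L)"
    using c L by (simp add: ennreal_mult mult_left_mono)
  with le have "grad_norm w g \<le> ennreal (c * L)" by (rule order_trans)
  then show "\<bar>g x - g y\<bar> \<le> c * L * gdist w x y"
    using c L by (simp add: grad_norm_le_iff)
next
  assume *: "\<forall>L>0::real. (\<forall>x y. \<bar>f x - f y\<bar> \<le> L * gdist w x y) \<longrightarrow>
      (\<forall>x y. \<bar>g x - g y\<bar> \<le> c * L * gdist w x y)"
  obtain C where C: "\<And>x. \<bar>f x\<bar> \<le> C"
    using f unfolding bounded_range_iff by blast
  have "0 \<le> C" using C[of undefined] by linarith
  \<comment> \<open>Distinct vertices have distance at least 1, so a bounded function has finite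
    gradient norm.\<close>
  have "\<bar>f x - f y\<bar> \<le> 2 * C * gdist w x y" for x y
  proof (cases "x = y")
    case False
    then have "2 * C * 1 \<le> 2 * C * gdist w x y"
      using gdist_pos[of x y] \<open>0 \<le> C\<close> by (intro mult_left_mono) auto
    then show ?thesis using C[of x] C[of y] by linarith
  qed simp
  then have "grad_norm w f \<le> ennreal (2 * C)"
    using \<open>0 \<le> C\<close> by (simp add: grad_norm_le_iff)
  then obtain L where L: "0 \<le> L" "grad_norm w f = ennreal L"
    by (cases "grad_norm w f") (auto simp: top_unique)
  have lipf: "\<bar>f x - f y\<bar> \<le> L * gdist w x y" for x y
    using grad_norm_le_iff[OF L(1), of f] L(2) by simp
  have "\<bar>g x - g y\<bar> \<le> c * L * gdist w x y" for x y
  proof (rule field_le_epsilon)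
    fix e :: real assume e: "0 < e"
    \<comment> \<open>Enlarging \<open>L\<close> to the positive L + e / k costs e (k - 1) / k,
      which is below \<open>e\<close>.\<close>
    define k where "k = c * gdist w x y + 1"
    have k: "0 < k" using c by (simp add: k_def add_nonneg_pos)
    have "\<bar>f x - f y\<bar> \<le> (L + e / k) * gdist w x y" for x y
      using e k by (intro order_trans[OF lipf] mult_right_mono) auto
    moreover have "0 < L + e / k" using L e k by (simp add: add_nonneg_pos)
    ultimately have "\<bar>g x - g y\<bar> \<le> c * (L + e / k) * gdist w x y" using * by blast
    also have "\<dots> = c * L * gdist w x y + e * ((k - 1) / k)"
      by (simp add: k_def algebra_simps)
    also have "e * ((k - 1) / k) \<le> e"
      using e k by (intro mult_left_le) auto
    finally show "\<bar>g x - g y\<bar> \<le> c * L * gdist w x y + e" by simp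
  qed
  then have "grad_norm w g \<le> ennreal (c * L)"
    using c L by (simp add: grad_norm_le_iff)
  then show "grad_norm w g \<le> ennreal c * grad_norm w f"
    using c L by (simp add: ennreal_mult)
qed

section \<open>Curvature and gradient estimates\<close>

lemma finitely_supported_bounded:
  assumes "finitely_supported f"
  shows "bounded (range f)"
proof -
  have "range f \<subseteq> insert 0 (f ` {x. f x \<noteq> 0})" by auto
  moreover have "finite (insert 0 (f ` {x. f x \<noteq> 0}))"
    using assms by (simp add: finitely_supported_def)
  ultimately show ?thesis
    using finite_imp_bounded finite_subset by blast
qed

lemma Ric_ge_imp_gradient_estimate:
  assumes ric: "Ric_ge w m K" and f: "bounded (range f)" and t: "0 < t"
  shows "grad_norm w (heat w m t f) \<le> ennreal (exp (- K * t)) * grad_norm w f"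
  unfolding grad_norm_contraction_iff[OF f exp_ge_zero]
proof (intro allI impI)
  fix L :: real and x y assume L: "0 < L" "\<forall>x y. \<bar>f x - f y\<bar> \<le> L * gdist w x y"
  obtain C where "\<And>x. \<bar>f x\<bar> \<le> C"
    using f unfolding bounded_range_iff by blast
  note C = abs_heat_le[OF this]
  have "heat w m t f y - heat w m t f x \<le> exp (- K * t) * L * gdist w x y" for x y
    using L t by (intro Ric_ge_solution_Lipschitz[OF ric heat_solves[OF f] C])
      (auto simp: heat_0[OF f])
  from this[of x y] this[of y x] show
    "\<bar>heat w m t f x - heat w m t f y\<bar> \<le> exp (- K * t) * L * gdist w x y"
    by (simp add: gdist_sym[of y x] abs_le_iff)
qed

lemma gradient_estimate_imp_Ric_ge:
  assumes est: "\<And>f t. \<lbrakk>finitely_supported f; 0 < t\<rbrakk> \<Longrightarrow>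
    grad_norm w (heat w m t f) \<le> ennreal (exp (- K * t)) * grad_norm w f"
  shows "Ric_ge w m K"
  unfolding Ric_ge_def
proof (intro allI impI)
  fix x y :: 'v assume xy: "x \<noteq> y"
  \<comment> \<open>The extra 1 puts the neighbours of \<open>y\<close>, too, into the ball around
    \<open>x\<close> on which the cutoff is exact.\<close>
  define n where "n = gdist w x y + 1"
  define A where "A z = 4 * Deg w m z * (Deg w m z + (\<Sum>v | (z, v) \<in> edges w. Deg w m v))" for z
  show "ereal K \<le> curvature w m x y"
  proof (rule curvature_ge[OF xy, where C = "(A x + A y) * (2 * real n)"])
    fix \<epsilon> :: real and f assume \<epsilon>: "0 < \<epsilon>" and f: "f \<in> bounded_Lip1"
    \<comment> \<open>Subtracting \<open>f x\<close> makes the cutoff applicable and leaves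
      differences and Laplacians, hence \<open>transport\<close>, unchanged. The bound 2 n on
      \<open>g\<close> is uniform in \<open>f\<close>.\<close>
    obtain g where g: "g \<in> Lip1 w" "finitely_supported g" "\<And>z. \<bar>g z\<bar> \<le> 2 * real n"
      "\<And>z. gdist w x z \<le> n \<Longrightarrow> g z = f z - f x"
      using Lip1_cutoff[where f = "\<lambda>z. f z - f x" and x = x and n = n]
        Lip1_diff_const[where f = f and c = "f x"] f
      by auto
    have near: "gdist w x z \<le> n" if "z \<in> {x, y} \<or> (x, z) \<in> edges w \<or> (y, z) \<in> edges w" for z
      using that gdist_edge[of x z] gdist_edge[of y z] gdist_triangle[of x z y]
      by (auto simp: n_def)
    have lap: "laplacian w m g z = laplacian w m f z" if "z \<in> {x, y}" for z
    proof -
      have "laplacian w m g z = laplacian w m (\<lambda>z. f z - f x) z"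
        using that near by (intro laplacian_cong g(4)) auto
      then show ?thesis by (simp add: laplacian_diff)
    qed
    have "\<bar>heat w m \<epsilon> g x - heat w m \<epsilon> g y\<bar> \<le> exp (- K * \<epsilon>) * 1 * gdist w x y"
      using est[OF g(2) \<epsilon>] g(1)
      unfolding grad_norm_contraction_iff[OF finitely_supported_bounded[OF g(2)] exp_ge_zero]
      by (auto simp: Lip1_def dest: spec[of _ 1])
    then have le: "heat w m \<epsilon> g x - heat w m \<epsilon> g y \<le> exp (- K * \<epsilon>) * gdist w x y" by simp
    have short: "\<bar>heat w m \<epsilon> g z - g z - \<epsilon> * laplacian w m g z\<bar> \<le> A z * (2 * real n) * \<epsilon>\<^sup>2" for z
      unfolding A_def using \<epsilon> by (intro heat_short_time g(3)) simp
    have "transport x y \<epsilon> f = transport x y \<epsilon> g"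
      unfolding transport_def using g(4)[OF near] lap by simp
    also have "\<dots> \<le> (heat w m \<epsilon> g x - heat w m \<epsilon> g y) + (A x + A y) * (2 * real n) * \<epsilon>\<^sup>2"
      using short[of x] short[of y] by (simp add: transport_def abs_le_iff algebra_simps)
    also have "\<dots> \<le> exp (- K * \<epsilon>) * gdist w x y + (A x + A y) * (2 * real n) * \<epsilon>\<^sup>2"
      using le by simp
    finally show "transport x y \<epsilon> f \<le> exp (- K * \<epsilon>) * gdist w x y + (A x + A y) * (2 * real n) * \<epsilon>\<^sup>2" .
  qed
qed

text \<open>\<open>P\<^sub>t 1\<close> has vanishing gradient, hence vanishing time derivative.\<close>

lemma gradient_estimate_imp_stochastically_complete:
  assumes est: "\<And>t. 0 < t \<Longrightarrow> grad_norm w (heat w m t (\<lambda>_. 1)) \<le>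
    ennreal (c t) * grad_norm w (\<lambda>_. 1)"
  shows "stochastically_complete w m"
proof -
  have b: "bounded (range (\<lambda>_ :: 'v. 1 :: real))" by simp
  have "grad_norm w (\<lambda>_. 1) \<le> ennreal 0"
    by (subst grad_norm_le_iff) auto
  then have g0: "grad_norm w (\<lambda>_. 1) = 0" by simp
  have const: "heat w m t (\<lambda>_. 1) y = heat w m t (\<lambda>_. 1) x" if t: "0 \<le> t" for t x y
  proof (cases "t = 0")
    case False
    then have "grad_norm w (heat w m t (\<lambda>_. 1)) \<le> ennreal 0"
      using est[of t] t g0 by simp
    then show ?thesis by (subst (asm) grad_norm_le_iff) auto
  qed (simp add: heat_0[OF b])
  have lap0: "laplacian w m (heat w m s (\<lambda>_. 1)) x = 0" if "0 \<le> s" for s x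
    using laplacian_cong[of x "heat w m s (\<lambda>_. 1)" "\<lambda>_. heat w m s (\<lambda>_. 1) x"] const[OF that, of _ x]
    by simp
  have "heat w m t (\<lambda>_. 1) x = 1" if "0 < t" for t x
  proof -
    have "norm (heat w m t (\<lambda>_. 1) x - heat w m 0 (\<lambda>_. 1) x) \<le> 0 * norm (t - 0)"
    proof (rule field_differentiable_bound[of "{0..}"])
      show "((\<lambda>t. heat w m t (\<lambda>_. 1) x) has_real_derivative 0) (at s within {0..})"
        if "s \<in> {0..}" for s
        using heat_solves[OF b, unfolded solves_heat_def, rule_format, of s x] lap0[of s x] that
        by simp
    qed (use \<open>0 < t\<close> in auto)
    then show ?thesis by (simp add: heat_0[OF b])
  qed
  then show ?thesis by (auto simp: stochastically_complete_def)
qed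

text \<open>The kernel integrates \<open>f\<close> to its evolution, so the dual problem for two
  kernels becomes a bound on differences of evolved Lipschitz functions.\<close>

lemma wasserstein_heat_kernel:
  assumes sc: "stochastically_complete w m" and t: "0 \<le> t"
  shows "wasserstein w (heat_kernel w m t x) (heat_kernel w m t y) =
    (SUP f\<in>bounded_Lip1. ereal (heat w m t f x - heat w m t f y))"
  unfolding wasserstein_def
proof (rule SUP_cong[OF refl])
  fix f assume "f \<in> bounded_Lip1"
  then have f: "bounded (range f)" by simp
  have "((\<lambda>z. f z * heat_kernel w m t x z + (- 1) * (f z * heat_kernel w m t y z)) has_sum
      heat w m t f x + (- 1) * heat w m t f y) UNIV"
    by (intro has_sum_add has_sum_cmult_right has_sum_heat_kernel sc f t)
  then have "((\<lambda>z. f z * (heat_kernel w m t x z - heat_kernel w m t y z)) has_sum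
      heat w m t f x - heat w m t f y) UNIV"
    by (simp add: algebra_simps)
  then show "ereal (\<Sum>\<^sub>\<infinity>z. f z * (heat_kernel w m t x z - heat_kernel w m t y z)) =
      ereal (heat w m t f x - heat w m t f y)"
    by (simp add: infsumI)
qed

text \<open>A negative factor exchanges the two parts from which \<open>heat\<close> is built;
  uniqueness treats all signs at once.\<close>

lemma heat_cmult:
  assumes sc: "stochastically_complete w m" and f: "bounded (range f)" and t: "0 \<le> t"
  shows "heat w m t (\<lambda>x. c * f x) x = c * heat w m t f x"
proof -
  obtain C where C: "\<And>x. \<bar>f x\<bar> \<le> C"
    using f unfolding bounded_range_iff by blast
  show ?thesis
  proof (rule heat_unique[OF sc solves_heat_cmult[OF heat_solves[OF f]] _ _ t])
    show "\<bar>c * heat w m t f x\<bar> \<le> \<bar>c\<bar> * C" if "0 \<le> t" for x t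
      using abs_heat_le[OF C that] by (simp add: abs_mult mult_left_mono)
  qed (simp add: heat_0[OF f])
qed

end

theorem theorem3p8:
  fixes w :: "'v::countable \<Rightarrow> 'v \<Rightarrow> real" and m :: "'v \<Rightarrow> real" and K :: real
  assumes "weighted_graph w m"
  defines "S1 \<equiv> Ric_ge w m K"
    and "S2 \<equiv> (\<forall>f. finitely_supported f \<longrightarrow>
               (\<forall>t>0. grad_norm w (heat w m t f) \<le> ennreal (exp (- K * t)) * grad_norm w f))"
    and "S3 \<equiv> (\<forall>f::'v \<Rightarrow> real. bounded (range f) \<longrightarrow>
               (\<forall>t>0. grad_norm w (heat w m t f) \<le> ennreal (exp (- K * t)) * grad_norm w f))"
    and "S4 \<equiv> stochastically_complete w m \<and>
               (\<forall>x y. \<forall>t>0. wasserstein w (heat_kernel w m t x) (heat_kernel w m t y)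
                              \<le> ereal (exp (- K * t) * real (gdist w x y)))"
  shows "(S1 \<longleftrightarrow> S2) \<and> (S2 \<longleftrightarrow> S3) \<and> (S3 \<longleftrightarrow> S4)"
proof -
  interpret weighted_graph w m by fact
  have 13: S3 if S1
    using that Ric_ge_imp_gradient_estimate unfolding S1_def S3_def by blast
  have 32: S2 if S3
    using that finitely_supported_bounded unfolding S2_def S3_def by blast
  have 21: S1 if S2
    using that gradient_estimate_imp_Ric_ge unfolding S1_def S2_def by blast
  have 34: S4 if S3
  proof -
    have sc: "stochastically_complete w m"
      using that unfolding S3_def
      by (intro gradient_estimate_imp_stochastically_complete[of "\<lambda>t. exp (- K * t)"]) auto
    moreover have "wasserstein w (heat_kernel w m t x) (heat_kernel w m t y)
        \<le> ereal (exp (- K * t) * real (gdist w x y))" if t: "0 < t" for x y t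
      unfolding wasserstein_heat_kernel[OF sc less_imp_le[OF t]]
    proof (rule SUP_least)
      fix f assume f: "f \<in> bounded_Lip1"
      then have bf: "bounded (range f)" by simp
      have "grad_norm w (heat w m t f) \<le> ennreal (exp (- K * t)) * grad_norm w f"
        using \<open>S3\<close> bf t unfolding S3_def by blast
      then have "\<bar>heat w m t f x - heat w m t f y\<bar> \<le> exp (- K * t) * 1 * gdist w x y"
        unfolding grad_norm_contraction_iff[OF bf exp_ge_zero]
        using f unfolding Lip1_def by (auto dest: spec[of _ 1])
      then show "ereal (heat w m t f x - heat w m t f y) \<le> ereal (exp (- K * t) * gdist w x y)"
        by simp
    qed
    ultimately show ?thesis unfolding S4_def by blast
  qed
  have 43: S3 if S4
    unfolding S3_def
  proof (intro allI impI)
    fix f :: "'v \<Rightarrow> real" and t :: real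
    assume f: "bounded (range f)" and t: "0 < t"
    have sc: "stochastically_complete w m" using that by (simp add: S4_def)
    show "grad_norm w (heat w m t f) \<le> ennreal (exp (- K * t)) * grad_norm w f"
      unfolding grad_norm_contraction_iff[OF f exp_ge_zero]
    proof (intro allI impI)
      fix L :: real and x y assume L: "0 < L" "\<forall>x y. \<bar>f x - f y\<bar> \<le> L * gdist w x y"
      \<comment> \<open>Statement (4) concerns slope 1 only; \<open>heat_cmult\<close> restores the
        factor \<open>L\<close> afterwards.\<close>
      let ?g = "\<lambda>x. (1 / L) * f x"
      have "\<bar>?g x - ?g y\<bar> \<le> gdist w x y" for x y
      proof -
        have "?g x - ?g y = (f x - f y) / L"
          by (simp add: diff_divide_distrib)
        then show ?thesis
          using L by (simp add: abs_divide pos_divide_le_eq mult.commute)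
      qed
      moreover have "bounded (range ?g)"
        using bounded_scaling[OF f, of "1 / L"] by (simp add: image_image)
      ultimately have g: "?g \<in> bounded_Lip1" by (simp add: Lip1_def)
      have "heat w m t f x - heat w m t f y \<le> exp (- K * t) * L * gdist w x y" for x y
      proof -
        have "ereal (heat w m t ?g x - heat w m t ?g y)
            \<le> wasserstein w (heat_kernel w m t x) (heat_kernel w m t y)"
          unfolding wasserstein_heat_kernel[OF sc less_imp_le[OF t]] by (rule SUP_upper[OF g])
        also have "\<dots> \<le> ereal (exp (- K * t) * gdist w x y)"
          using \<open>S4\<close> t by (simp add: S4_def)
        finally have "(1 / L) * (heat w m t f x - heat w m t f y) \<le> exp (- K * t) * gdist w x y"
          using t by (simp only: heat_cmult[OF sc f] less_imp_le right_diff_distrib ereal_less_eq)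
        then show ?thesis using L(1) by (simp add: field_simps)
      qed
      from this[of x y] this[of y x]
      show "\<bar>heat w m t f x - heat w m t f y\<bar> \<le> exp (- K * t) * L * gdist w x y"
        by (simp add: gdist_sym[of y x] abs_le_iff)
    qed
  qed
  show ?thesis using 13 32 21 34 43 by blast
qed

end
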